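(* Let $(R,\mathfrak m,k)$ be a commutative noetherian local ring with $\mathfrak m^4=0$ and $H_R(-1)=0$. Suppose $a,b\in\mathfrak m\smallsetminus\mathfrak m^2$ form an exact pair of zero divisors. Then: (1) the initial forms $a^*,b^*$ in $\operatorname{gr}_{\mathfrak m}(R)$ form an exact pair of zero divisors in $\operatorname{gr}_{\mathfrak m}(R)$; (2) the graded rings $\operatorname{gr}_{\mathfrak m/aR}(R/aR)$ and $\operatorname{gr}_{\mathfrak m}(R)/a^*\operatorname{gr}_{\mathfrak m}(R)$ are naturally isomorphic (via the map induced by $R\to R/aR$); (3) $H_{\operatorname{gr}_{\mathfrak m}(R)/a^*\operatorname{gr}_{\mathfrak m}(R)}(t)=H_{R/aR}(t)=H_R(t)(1+t)^{-1}$.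
   Context: $H_R(t)=\sum_{n\ge0}\operatorname{rank}_k(\mathfrak m^n/\mathfrak m^{n+1})t^n$ is the Hilbert series of the local ring $R$ (for graded rings, the Hilbert series is $\sum_n \operatorname{rank}_k(\text{degree-}n\text{ part})t^n$). $\operatorname{gr}_{\mathfrak m}(R)=\bigoplus_{n\ge0}\mathfrak m^n/\mathfrak m^{n+1}$ is the associated graded ring, and $r^*$ denotes the initial form of $r\in R$. Elements $a,b$ of a ring form an exact pair of zero divisors if they are nonzero non-units with $(0:a)=bR$ and $(0:b)=aR$. *)

theory Defs
  imports "HOL-Computational_Algebra.Polynomial_FPS"
    "HOL-Algebra.Ideal_Product" "HOL-Algebra.Ring_Divisibility" "HOL-Algebra.QuotRing"
begin

fun ideal_pow :: "('a, 'b) ring_scheme \<Rightarrow> 'a set \<Rightarrow> nat \<Rightarrow> 'a set" where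
  "ideal_pow R I 0 = carrier R"
| "ideal_pow R I (Suc n) = ideal_prod R I (ideal_pow R I n)"

definition local_noetherian :: "('a, 'b) ring_scheme \<Rightarrow> 'a set \<Rightarrow> bool" where
  "local_noetherian R m \<longleftrightarrow> cring R \<and> noetherian_ring R \<and> maximalideal m R
     \<and> (\<forall>J. maximalideal J R \<longrightarrow> J = m)"

definition annihilator :: "('a, 'b) ring_scheme \<Rightarrow> 'a \<Rightarrow> 'a set" where
  "annihilator S x = {y \<in> carrier S. x \<otimes>\<^bsub>S\<^esub> y = \<zero>\<^bsub>S\<^esub>}"

definition exact_zd_pair :: "('a, 'b) ring_scheme \<Rightarrow> 'a \<Rightarrow> 'a \<Rightarrow> bool" where
  "exact_zd_pair S a b \<longleftrightarrow> a \<in> carrier S \<and> b \<in> carrier S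
     \<and> a \<noteq> \<zero>\<^bsub>S\<^esub> \<and> b \<noteq> \<zero>\<^bsub>S\<^esub> \<and> a \<notin> Units S \<and> b \<notin> Units S
     \<and> annihilator S a = PIdl\<^bsub>S\<^esub> b \<and> annihilator S b = PIdl\<^bsub>S\<^esub> a"

text \<open>An element of gr_I(R) = (+)_n I^n/I^(n+1) is a family f of cosets, f n being a coset of
  I^(n+1) inside I^n, almost all of them zero.\<close>

definition some_rep :: "'a set \<Rightarrow> 'a" where
  "some_rep X = (SOME x. x \<in> X)"

definition gr :: "('a, 'b) ring_scheme \<Rightarrow> 'a set \<Rightarrow> (nat \<Rightarrow> 'a set) ring" where
  "gr R I = \<lparr> carrier = {f. (\<forall>n. \<exists>x \<in> ideal_pow R I n. f n = ideal_pow R I (Suc n) +>\<^bsub>R\<^esub> x)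
                            \<and> finite {n. f n \<noteq> ideal_pow R I (Suc n)}},
              mult = (\<lambda>f g n. ideal_pow R I (Suc n) +>\<^bsub>R\<^esub>
                         (\<Oplus>\<^bsub>R\<^esub> i \<in> {..n}. some_rep (f i) \<otimes>\<^bsub>R\<^esub> some_rep (g (n - i)))),
              one = (\<lambda>n. if n = 0 then ideal_pow R I (Suc 0) +>\<^bsub>R\<^esub> \<one>\<^bsub>R\<^esub>
                         else ideal_pow R I (Suc n)),
              zero = (\<lambda>n. ideal_pow R I (Suc n)),
              add = (\<lambda>f g n. f n <+>\<^bsub>R\<^esub> g n) \<rparr>"

definition gr_part :: "('a, 'b) ring_scheme \<Rightarrow> 'a set \<Rightarrow> nat \<Rightarrow> (nat \<Rightarrow> 'a set) set" where
  "gr_part R I d = {f \<in> carrier (gr R I). \<forall>n. n \<noteq> d \<longrightarrow> f n = ideal_pow R I (Suc n)}"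

definition initial_form :: "('a, 'b) ring_scheme \<Rightarrow> 'a set \<Rightarrow> 'a \<Rightarrow> (nat \<Rightarrow> 'a set)" where
  "initial_form R I r = (let d = (GREATEST n. r \<in> ideal_pow R I n) in
      (\<lambda>n. if n = d then ideal_pow R I (Suc n) +>\<^bsub>R\<^esub> r else ideal_pow R I (Suc n)))"

definition gr_map :: "('a, 'b) ring_scheme \<Rightarrow> 'a set \<Rightarrow> ('c, 'd) ring_scheme \<Rightarrow> 'c set
                      \<Rightarrow> ('a \<Rightarrow> 'c) \<Rightarrow> (nat \<Rightarrow> 'a set) \<Rightarrow> (nat \<Rightarrow> 'c set)" where
  "gr_map R I S J phi f = (\<lambda>n. ideal_pow S J (Suc n) +>\<^bsub>S\<^esub> phi (some_rep (f n)))"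

text \<open>rank_k(m^n/m^(n+1)), k = R/m: the minimal size of a family in m^n whose classes span
  m^n/m^(n+1) over k (coefficients taken in R, acting through R/m).\<close>
definition local_rank :: "('a, 'b) ring_scheme \<Rightarrow> 'a set \<Rightarrow> nat \<Rightarrow> nat" where
  "local_rank R m n = (LEAST r. \<exists>xs. length xs = r \<and> set xs \<subseteq> ideal_pow R m n \<and>
      (\<forall>y \<in> ideal_pow R m n. \<exists>c \<in> {..<r} \<rightarrow> carrier R.
          y \<ominus>\<^bsub>R\<^esub> (\<Oplus>\<^bsub>R\<^esub> i \<in> {..<r}. c i \<otimes>\<^bsub>R\<^esub> xs ! i) \<in> ideal_pow R m (Suc n)))"

definition hilbert_series :: "('a, 'b) ring_scheme \<Rightarrow> 'a set \<Rightarrow> rat fps" where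
  "hilbert_series R m = Abs_fps (\<lambda>n. of_nat (local_rank R m n))"

text \<open>For a graded ring S with degree-n parts D n (D 0 = k a field), rank_k of D n:
  minimal size of a family in D n spanning D n over D 0.\<close>
definition graded_rank :: "('a, 'b) ring_scheme \<Rightarrow> (nat \<Rightarrow> 'a set) \<Rightarrow> nat \<Rightarrow> nat" where
  "graded_rank S D n = (LEAST r. \<exists>xs. length xs = r \<and> set xs \<subseteq> D n \<and>
      (\<forall>y \<in> D n. \<exists>c \<in> {..<r} \<rightarrow> D 0. y = (\<Oplus>\<^bsub>S\<^esub> i \<in> {..<r}. c i \<otimes>\<^bsub>S\<^esub> xs ! i)))"

definition graded_hilbert_series :: "('a, 'b) ring_scheme \<Rightarrow> (nat \<Rightarrow> 'a set) \<Rightarrow> rat fps" where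
  "graded_hilbert_series S D = Abs_fps (\<lambda>n. of_nat (graded_rank S D n))"

end

theory Submission
  imports Defs "HOL-Algebra.UnivPoly" "HOL-Algebra.Subrings"
begin

text \<open>
  Write \<open>h\<^sub>n\<close> for the rank of \<open>m\<^sup>n / m\<^sup>n\<^sup>+\<^sup>1\<close>. Since \<open>a\<close> and \<open>b\<close> kill \<open>m\<^sup>3\<close> and lie outside \<open>m\<^sup>2\<close>, there is a
  chain \<open>a m\<^sup>2 \<subseteq> m\<^sup>3 \<subseteq> a m \<subseteq> m\<^sup>2\<close>, and likewise for \<open>b\<close>. Multiplication by \<open>a\<close> induces isomorphisms
  \<open>m / (b R + m\<^sup>2) \<cong> a m / a m\<^sup>2\<close> and \<open>m\<^sup>2 / b m \<cong> a m\<^sup>2\<close>. With \<open>g\<^sub>a\<close>, \<open>g\<^sub>b\<close> the ranks of \<open>m\<^sup>2 / a m\<close>, \<open>m\<^sup>2 / b m\<close>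
  and \<open>\<delta>\<^sub>a\<close>, \<open>\<delta>\<^sub>b\<close> those of \<open>m\<^sup>3 / a m\<^sup>2\<close>, \<open>m\<^sup>3 / b m\<^sup>2\<close>, additivity gives \<open>h\<^sub>2 = g\<^sub>a + (h\<^sub>1 - 1) - \<delta>\<^sub>a\<close> and
  \<open>h\<^sub>3 = \<delta>\<^sub>a + g\<^sub>b = \<delta>\<^sub>b + g\<^sub>a\<close>. As \<open>H(-1) = 0\<close> means \<open>h\<^sub>2 = h\<^sub>1 - 1 + h\<^sub>3\<close>, both defects vanish, that is,
  \<open>a m\<^sup>2 = m\<^sup>3 = b m\<^sup>2\<close>. This determines the annihilator of \<open>a\<^sup>*\<close> and the kernel of
  \<open>gr(R) \<rightarrow> gr(R/aR)\<close> degree by degree, as well as the Hilbert series of \<open>R/aR\<close>.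
\<close>

subsection \<open>Relative ranks\<close>

text \<open>The set N + C x_1 + ... + C x_r, peeled off one generator at a time, so that span
  arguments become list inductions without indexed sums.\<close>

fun lspan :: "('a, 'b) ring_scheme \<Rightarrow> 'a set \<Rightarrow> 'a set \<Rightarrow> 'a list \<Rightarrow> 'a set" where
  "lspan R C N [] = N"
| "lspan R C N (x # xs) = {y \<in> carrier R. \<exists>c\<in>C. y \<ominus>\<^bsub>R\<^esub> c \<otimes>\<^bsub>R\<^esub> x \<in> lspan R C N xs}"

text \<open>With \<open>C = R\<close> and \<open>m M \<subseteq> N \<subseteq> M\<close> this is the dimension of \<open>M / N\<close> over the residue field; the
  coefficient set \<open>C\<close> is a parameter so that graded ranks over the degree-zero part are covered too.\<close>

definition rel_rank :: "('a, 'b) ring_scheme \<Rightarrow> 'a set \<Rightarrow> 'a set \<Rightarrow> 'a set \<Rightarrow> nat" where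
  "rel_rank R C M N = (LEAST r. \<exists>xs. length xs = r \<and> set xs \<subseteq> M \<and> M \<subseteq> lspan R C N xs)"

lemma lspan_append: "lspan R C N (xs @ ys) = lspan R C (lspan R C N ys) xs"
  by (induction xs) auto

lemma lspan_mono: "N \<subseteq> N' \<Longrightarrow> lspan R C N xs \<subseteq> lspan R C N' xs"
  by (induction xs) auto

text \<open>Connects the recursive span with the indexed sums in the definitions of the ranks.
  Induction from the right end keeps the indices of the earlier generators; the last generator is
  absorbed into \<open>N\<close>, which is why \<open>N\<close> is arbitrary.\<close>

lemma (in cring) lspan_iff_finsum:
  assumes "C \<subseteq> carrier R" "set xs \<subseteq> carrier R" "y \<in> carrier R"
  shows "y \<in> lspan R C N xs \<longleftrightarrow>
    (\<exists>c \<in> {..<length xs} \<rightarrow> C. y \<ominus> (\<Oplus>i\<in>{..<length xs}. c i \<otimes> xs ! i) \<in> N)"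
  using assms
proof (induction xs arbitrary: N rule: rev_induct)
  case Nil
  then show ?case by (simp add: a_minus_def)
next
  case (snoc x xs)
  let ?n = "length xs"
  let ?S = "\<lambda>c. \<Oplus>i\<in>{..<?n}. c i \<otimes> xs ! i"
  have x: "x \<in> carrier R" and xs: "\<And>i. i < ?n \<Longrightarrow> xs ! i \<in> carrier R"
    using snoc.prems by auto
  have S: "?S c \<in> carrier R" if "c \<in> {..<?n} \<rightarrow> C" for c
    using that snoc.prems(1) xs by (intro finsum_closed) auto
  have minus_minus: "(y \<ominus> s) \<ominus> t = y \<ominus> (t \<oplus> s)" if "s \<in> carrier R" "t \<in> carrier R" for s t
    using that snoc.prems(3) by algebra
  have step: "(\<Oplus>i\<in>{..<length (xs @ [x])}. c i \<otimes> (xs @ [x]) ! i) = c ?n \<otimes> x \<oplus> ?S c"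
    if c: "c \<in> {..<Suc ?n} \<rightarrow> C" for c
  proof -
    have "(\<Oplus>i\<in>{..<?n}. c i \<otimes> (xs @ [x]) ! i) = ?S c"
      using c snoc.prems(1) xs by (intro finsum_cong') (auto simp: nth_append Pi_iff subset_iff)
    then show ?thesis
      using c snoc.prems(1) x xs
      by (subst length_append_singleton, subst lessThan_Suc, subst finsum_insert)
        (auto simp: nth_append Pi_iff subset_iff)
  qed
  have "y \<in> lspan R C N (xs @ [x]) \<longleftrightarrow>
    (\<exists>c \<in> {..<?n} \<rightarrow> C. \<exists>d\<in>C. (y \<ominus> ?S c) \<ominus> d \<otimes> x \<in> N)"
    using snoc S by (auto simp: lspan_append)
  also have "\<dots> \<longleftrightarrow> (\<exists>c \<in> {..<Suc ?n} \<rightarrow> C. y \<ominus> (c ?n \<otimes> x \<oplus> ?S c) \<in> N)"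
  proof
    assume "\<exists>c \<in> {..<?n} \<rightarrow> C. \<exists>d\<in>C. (y \<ominus> ?S c) \<ominus> d \<otimes> x \<in> N"
    then obtain c d where cd: "c \<in> {..<?n} \<rightarrow> C" "d \<in> C" "(y \<ominus> ?S c) \<ominus> d \<otimes> x \<in> N"
      by blast
    have "?S (c(?n := d)) = ?S c"
      using cd snoc.prems(1) xs by (intro finsum_cong') auto
    moreover have "(y \<ominus> ?S c) \<ominus> d \<otimes> x = y \<ominus> (d \<otimes> x \<oplus> ?S c)"
      using cd S[OF cd(1)] snoc.prems(1,3) x by (intro minus_minus) auto
    ultimately show "\<exists>c \<in> {..<Suc ?n} \<rightarrow> C. y \<ominus> (c ?n \<otimes> x \<oplus> ?S c) \<in> N"
      using cd by (intro bexI[of _ "c(?n := d)"]) (auto simp: less_Suc_eq)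
  next
    assume "\<exists>c \<in> {..<Suc ?n} \<rightarrow> C. y \<ominus> (c ?n \<otimes> x \<oplus> ?S c) \<in> N"
    then obtain c where c: "c \<in> {..<Suc ?n} \<rightarrow> C" "y \<ominus> (c ?n \<otimes> x \<oplus> ?S c) \<in> N"
      by blast
    have c': "c \<in> {..<?n} \<rightarrow> C" "c ?n \<in> C"
      using c(1) by auto
    have "(y \<ominus> ?S c) \<ominus> c ?n \<otimes> x = y \<ominus> (c ?n \<otimes> x \<oplus> ?S c)"
      using c' S[OF c'(1)] snoc.prems(1,3) x by (intro minus_minus) auto
    then show "\<exists>c \<in> {..<?n} \<rightarrow> C. \<exists>d\<in>C. (y \<ominus> ?S c) \<ominus> d \<otimes> x \<in> N"
      using c c' by (intro bexI[of _ c] bexI[of _ "c ?n"]) auto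
  qed
  also have "\<dots> \<longleftrightarrow> (\<exists>c \<in> {..<length (xs @ [x])} \<rightarrow> C.
      y \<ominus> (\<Oplus>i\<in>{..<length (xs @ [x])}. c i \<otimes> (xs @ [x]) ! i) \<in> N)"
    using step by (intro bex_cong) auto
  finally show ?case .
qed

text \<open>Inside a graded piece nothing is divided out, so an equality is read as a difference
  lying in {0}, with coefficients from the degree-zero part.\<close>

lemma (in cring) graded_rank_eq_rel_rank:
  assumes "\<And>n. D n \<subseteq> carrier R"
  shows "graded_rank R D n = rel_rank R (D 0) (D n) {\<zero>}"
proof -
  have *: "(\<forall>y \<in> D n. \<exists>c \<in> {..<length xs} \<rightarrow> D 0. y = (\<Oplus>i\<in>{..<length xs}. c i \<otimes> xs ! i))
      \<longleftrightarrow> D n \<subseteq> lspan R (D 0) {\<zero>} xs" if xs: "set xs \<subseteq> D n" for xs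
  proof -
    have "y = (\<Oplus>i\<in>{..<length xs}. c i \<otimes> xs ! i) \<longleftrightarrow>
      y \<ominus> (\<Oplus>i\<in>{..<length xs}. c i \<otimes> xs ! i) \<in> {\<zero>}"
      if "y \<in> D n" "c \<in> {..<length xs} \<rightarrow> D 0" for y c
    proof -
      have "(\<Oplus>i\<in>{..<length xs}. c i \<otimes> xs ! i) \<in> carrier R"
      proof (rule finsum_closed, rule Pi_I)
        fix i assume "i \<in> {..<length xs}"
        then have "c i \<in> D 0" "xs ! i \<in> D n"
          using that(2) xs nth_mem[of i xs] by auto
        then show "c i \<otimes> xs ! i \<in> carrier R"
          using assms by blast
      qed
      moreover have "y \<in> carrier R"
        using that(1) assms by blast
      ultimately show ?thesis
        by simp
    qed
    moreover have "set xs \<subseteq> carrier R"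
      using xs assms by blast
    moreover have "y \<in> lspan R (D 0) {\<zero>} xs \<longleftrightarrow> (\<exists>c \<in> {..<length xs} \<rightarrow> D 0.
        y \<ominus> (\<Oplus>i\<in>{..<length xs}. c i \<otimes> xs ! i) \<in> {\<zero>})" if "y \<in> D n" for y
      using that assms calculation(2) by (intro lspan_iff_finsum) blast+
    ultimately show ?thesis
      unfolding subset_iff[of "D n"] Ball_def by (simp cong: bex_cong)
  qed
  show ?thesis
    unfolding graded_rank_def rel_rank_def
    by (intro arg_cong[where f = Least] ext) (use * in blast)
qed

text \<open>Source of the rank comparisons along maps: \<open>f\<close> is a surjection, semilinear
  along \<open>g\<close>, under which N is the preimage of N', so it matches M/N with M'/N'.
  Spanning lists are pushed forward along \<open>f\<close> and pulled back by choosing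
  preimages.\<close>

lemma rel_rank_transfer:
  assumes M: "M \<subseteq> carrier R" "\<And>x y c. \<lbrakk>x \<in> M; y \<in> M; c \<in> C\<rbrakk> \<Longrightarrow> x \<ominus>\<^bsub>R\<^esub> c \<otimes>\<^bsub>R\<^esub> y \<in> M"
    and f: "f ` M = M'" "M' \<subseteq> carrier S" and g: "g ` C = C'"
    and lin: "\<And>x y c. \<lbrakk>x \<in> M; y \<in> M; c \<in> C\<rbrakk> \<Longrightarrow>
      f (x \<ominus>\<^bsub>R\<^esub> c \<otimes>\<^bsub>R\<^esub> y) = f x \<ominus>\<^bsub>S\<^esub> g c \<otimes>\<^bsub>S\<^esub> f y"
    and N: "\<And>x. x \<in> M \<Longrightarrow> f x \<in> N' \<longleftrightarrow> x \<in> N"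
  shows "rel_rank R C M N = rel_rank S C' M' N'"
proof -
  have lspan: "y \<in> lspan R C N xs \<longleftrightarrow> f y \<in> lspan S C' N' (map f xs)"
    if "y \<in> M" "set xs \<subseteq> M" for y xs
    using that
  proof (induction xs arbitrary: y)
    case Nil
    then show ?case using N by simp
  next
    case (Cons x xs)
    have "y \<ominus>\<^bsub>R\<^esub> c \<otimes>\<^bsub>R\<^esub> x \<in> lspan R C N xs \<longleftrightarrow> f y \<ominus>\<^bsub>S\<^esub> g c \<otimes>\<^bsub>S\<^esub> f x \<in> lspan S C' N' (map f xs)"
      if "c \<in> C" for c
      using Cons.IH[of "y \<ominus>\<^bsub>R\<^esub> c \<otimes>\<^bsub>R\<^esub> x"] Cons.prems lin[of y x c] M(2)[of y x c] that by auto
    then show ?case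
      using Cons.prems M(1) f g by auto
  qed
  have "(\<exists>xs. length xs = r \<and> set xs \<subseteq> M \<and> M \<subseteq> lspan R C N xs) \<longleftrightarrow>
    (\<exists>xs. length xs = r \<and> set xs \<subseteq> M' \<and> M' \<subseteq> lspan S C' N' xs)" for r
  proof
    assume "\<exists>xs. length xs = r \<and> set xs \<subseteq> M \<and> M \<subseteq> lspan R C N xs"
    then obtain xs where "length xs = r" "set xs \<subseteq> M" "M \<subseteq> lspan R C N xs"
      by blast
    then show "\<exists>xs. length xs = r \<and> set xs \<subseteq> M' \<and> M' \<subseteq> lspan S C' N' xs"
      using f(1) lspan by (intro exI[of _ "map f xs"]) auto
  next
    assume "\<exists>xs. length xs = r \<and> set xs \<subseteq> M' \<and> M' \<subseteq> lspan S C' N' xs"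
    then obtain ys where ys: "length ys = r" "set ys \<subseteq> M'" "M' \<subseteq> lspan S C' N' ys"
      by blast
    define xs where "xs = map (inv_into M f) ys"
    have "set xs \<subseteq> M"
      unfolding xs_def using ys(2) f(1) by (auto intro: inv_into_into)
    moreover have "ys = map f xs"
      unfolding xs_def map_map
      by (rule map_idI[symmetric]) (use ys(2) f(1) in \<open>auto simp: f_inv_into_f\<close>)
    ultimately show "\<exists>xs. length xs = r \<and> set xs \<subseteq> M \<and> M \<subseteq> lspan R C N xs"
      using ys f(1) lspan by (intro exI[of _ xs]) auto
  qed
  then show ?thesis
    unfolding rel_rank_def by simp
qed

lemma (in ideal) minus_closed_I: "\<lbrakk>x \<in> I; y \<in> I\<rbrakk> \<Longrightarrow> x \<ominus> y \<in> I"
  by (simp add: a_minus_def)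

lemma (in ideal) minus_mem_cancel:
  assumes "x \<in> carrier R" "y \<in> I" "x \<ominus> y \<in> I"
  shows "x \<in> I"
proof -
  have "x = (x \<ominus> y) \<oplus> y"
    using assms by (simp add: a_minus_def a_assoc l_neg)
  then show ?thesis
    using additive_subgroup.a_closed[OF is_additive_subgroup assms(3,2)] by simp
qed

lemma (in cring) lspan_ideal:
  assumes "ideal N R" "set xs \<subseteq> carrier R"
  shows "ideal (lspan R (carrier R) N xs) R" and "N \<subseteq> lspan R (carrier R) N xs"
    and "set xs \<subseteq> lspan R (carrier R) N xs"
proof -
  have "ideal (lspan R (carrier R) N xs) R \<and> N \<union> set xs \<subseteq> lspan R (carrier R) N xs"
    using assms(2)
  proof (induction xs)
    case Nil
    then show ?case using assms by simp
  next
    case (Cons x xs)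
    let ?L = "lspan R (carrier R) N xs"
    have x: "x \<in> carrier R" and L: "ideal ?L R" "N \<union> set xs \<subseteq> ?L"
      using Cons by auto
    interpret L: ideal ?L R by (rule L(1))
    have sub: "?L \<subseteq> lspan R (carrier R) N (x # xs)"
      using x by (auto simp: a_minus_def intro!: bexI[of _ \<zero>])
    have x_mem: "x \<in> lspan R (carrier R) N (x # xs)"
      using x by (auto intro!: bexI[of _ \<one>] simp: a_minus_def r_neg)
    have mult: "s \<otimes> y \<in> lspan R (carrier R) N (x # xs)"
      if "y \<in> lspan R (carrier R) N (x # xs)" "s \<in> carrier R" for s y
    proof -
      obtain c where c: "c \<in> carrier R" "y \<in> carrier R" "y \<ominus> c \<otimes> x \<in> ?L"
        using \<open>y \<in> _\<close> by auto
      have "s \<otimes> y \<ominus> (s \<otimes> c) \<otimes> x = s \<otimes> (y \<ominus> c \<otimes> x)"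
        using c x that(2) by algebra
      then show ?thesis
        using c x that(2) L.I_l_closed by (auto intro!: bexI[of _ "s \<otimes> c"])
    qed
    have "ideal (lspan R (carrier R) N (x # xs)) R"
    proof (rule idealI)
      show "ring R" by (rule ring_axioms)
      show "subgroup (lspan R (carrier R) N (x # xs)) (add_monoid R)"
      proof (rule add.subgroupI)
        show "lspan R (carrier R) N (x # xs) \<noteq> {}"
          using x_mem by blast
        fix y assume y: "y \<in> lspan R (carrier R) N (x # xs)"
        have "\<ominus> y = (\<ominus> \<one>) \<otimes> y"
          using y by (auto simp: l_minus)
        then show "\<ominus> y \<in> lspan R (carrier R) N (x # xs)"
          using mult[OF y] by simp
        fix z assume z: "z \<in> lspan R (carrier R) N (x # xs)"
        obtain c where c: "c \<in> carrier R" "y \<in> carrier R" "y \<ominus> c \<otimes> x \<in> ?L"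
          using y by auto
        obtain d where d: "d \<in> carrier R" "z \<in> carrier R" "z \<ominus> d \<otimes> x \<in> ?L"
          using z by auto
        have "(y \<oplus> z) \<ominus> (c \<oplus> d) \<otimes> x = (y \<ominus> c \<otimes> x) \<oplus> (z \<ominus> d \<otimes> x)"
          using c d x by algebra
        then show "y \<oplus> z \<in> lspan R (carrier R) N (x # xs)"
          using c d by (auto intro!: bexI[of _ "c \<oplus> d"])
      qed auto
      show "s \<otimes> y \<in> lspan R (carrier R) N (x # xs)"
        if "y \<in> lspan R (carrier R) N (x # xs)" "s \<in> carrier R" for s y
        using mult that .
      then show "y \<otimes> s \<in> lspan R (carrier R) N (x # xs)"
        if "y \<in> lspan R (carrier R) N (x # xs)" "s \<in> carrier R" for s y
        using that m_comm[of y s] by auto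
    qed
    then show ?case
      using sub x_mem L by auto
  qed
  then show "ideal (lspan R (carrier R) N xs) R" "N \<subseteq> lspan R (carrier R) N xs"
    "set xs \<subseteq> lspan R (carrier R) N xs" by auto
qed

lemma (in cring) lspan_subset_ideal:
  assumes "ideal M R" "N \<subseteq> M" "set xs \<subseteq> M"
  shows "lspan R (carrier R) N xs \<subseteq> M"
  using assms(3)
proof (induction xs)
  case Nil
  then show ?case using assms by simp
next
  case (Cons x xs)
  interpret M: ideal M R by (rule assms(1))
  show ?case
  proof
    fix y assume "y \<in> lspan R (carrier R) N (x # xs)"
    then obtain c where c: "y \<in> carrier R" "c \<in> carrier R" "y \<ominus> c \<otimes> x \<in> lspan R (carrier R) N xs"
      by auto
    then have "y \<ominus> c \<otimes> x \<in> M" "c \<otimes> x \<in> M"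
      using Cons M.I_l_closed by auto
    then show "y \<in> M"
      using M.minus_mem_cancel c(1) by blast
  qed
qed

section \<open>Ranks over the residue field\<close>

locale noetherian_maximal = maximalideal m R + noetherian_ring R + cring R for m and R (structure)
begin

abbreviation rank where "rank \<equiv> rel_rank R (carrier R)"

text \<open>By maximality m + rR is the whole ring, so 1 has the form s r + t with t in m.\<close>

lemma inverse_mod_m:
  assumes "r \<in> carrier R" "r \<notin> m"
  shows "\<exists>s\<in>carrier R. \<one> \<ominus> s \<otimes> r \<in> m"
proof -
  have "ideal (lspan R (carrier R) m [r]) R" "m \<subseteq> lspan R (carrier R) m [r]"
    "r \<in> lspan R (carrier R) m [r]"
    using lspan_ideal[of m "[r]"] assms is_ideal by auto
  then have "lspan R (carrier R) m [r] = carrier R"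
    using I_maximal[of "lspan R (carrier R) m [r]"] assms(2)
    by (metis additive_subgroup.a_subset ideal_def)
  then have "\<one> \<in> lspan R (carrier R) m [r]"
    by simp
  then show ?thesis
    by simp
qed

text \<open>Ensures that the \<open>LEAST\<close> in \<open>rel_rank\<close> is attained:
  noetherianity gives finitely many generators of M, and they span M modulo any N.\<close>

lemma finite_spanning_list:
  assumes "ideal M R" "ideal N R"
  shows "\<exists>xs. set xs \<subseteq> M \<and> M \<subseteq> lspan R (carrier R) N xs"
proof -
  obtain A where A: "A \<subseteq> carrier R" "finite A" "M = Idl A"
    using finetely_gen[OF assms(1)] by blast
  obtain xs where xs: "set xs = A"
    using finite_list[OF A(2)] by blast
  have "M \<subseteq> lspan R (carrier R) N xs"
    using A xs lspan_ideal[OF assms(2), of xs] genideal_minimal[of _ A] by auto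
  moreover have "set xs \<subseteq> M"
    using A xs genideal_self by simp
  ultimately show ?thesis by blast
qed

lemma rank_obtain:
  assumes "ideal M R" "ideal N R"
  obtains xs where "length xs = rank M N" "set xs \<subseteq> M" "M \<subseteq> lspan R (carrier R) N xs"
proof -
  let ?P = "\<lambda>r. \<exists>xs. length xs = r \<and> set xs \<subseteq> M \<and> M \<subseteq> lspan R (carrier R) N xs"
  have "\<exists>r. ?P r"
    using finite_spanning_list[OF assms] by blast
  then have "?P (rank M N)"
    unfolding rel_rank_def by (rule LeastI_ex)
  then show ?thesis using that by blast
qed

lemma rank_le:
  assumes "set xs \<subseteq> M" "M \<subseteq> lspan R (carrier R) N xs"
  shows "rank M N \<le> length xs"
  unfolding rel_rank_def using assms by (intro Least_le) auto

lemma rank_eq_0_iff: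
  assumes "ideal M R" "ideal N R"
  shows "rank M N = 0 \<longleftrightarrow> M \<subseteq> N"
proof
  assume "rank M N = 0"
  moreover obtain xs where "length xs = rank M N" "M \<subseteq> lspan R (carrier R) N xs"
    using rank_obtain[OF assms] .
  ultimately show "M \<subseteq> N" by simp
next
  assume "M \<subseteq> N"
  then show "rank M N = 0"
    using rank_le[of "[]" M N] by simp
qed

text \<open>Induction on the spanning list: a new generator \<open>x\<close> either enlarges \<open>M\<close> without meeting \<open>N\<close>,
  or, since scalars outside \<open>m\<close> are invertible modulo \<open>m\<close>, may be exchanged for an element of \<open>N\<close>.\<close>

lemma lspan_split:
  assumes "ideal P R" "set xs \<subseteq> carrier R" "ideal N R" "P \<subseteq> N" "N \<subseteq> lspan R (carrier R) P xs"
    and "\<And>t x. \<lbrakk>t \<in> m; x \<in> set xs\<rbrakk> \<Longrightarrow> t \<otimes> x \<in> P"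
  shows "\<exists>us vs. set us \<subseteq> lspan R (carrier R) P xs \<and> set vs \<subseteq> N \<and>
    lspan R (carrier R) P xs \<subseteq> lspan R (carrier R) N us \<and> N \<subseteq> lspan R (carrier R) P vs \<and>
    length us + length vs \<le> length xs"
  using assms(2-)
proof (induction xs arbitrary: N)
  case Nil
  then show ?case by (intro exI[of _ "[]"] exI[of _ "[]"]) auto
next
  case (Cons x xs)
  let ?M = "lspan R (carrier R) P xs" and ?M1 = "lspan R (carrier R) P (x # xs)"
  have x: "x \<in> carrier R" and xs: "set xs \<subseteq> carrier R"
    using Cons.prems by auto
  have M: "ideal ?M R" "P \<subseteq> ?M" and M1: "ideal ?M1 R" "set (x # xs) \<subseteq> ?M1"
    using lspan_ideal[OF assms(1) xs] lspan_ideal[OF assms(1) Cons.prems(1)] by blast+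
  have MM1: "?M \<subseteq> ?M1"
    using lspan_subset_ideal[OF M1(1), of P xs] lspan_ideal[OF assms(1) Cons.prems(1)] by auto
  interpret M: ideal ?M R by (rule M(1))
  interpret N: ideal N R by (rule Cons.prems(2))
  \<comment> \<open>The induction hypothesis is applied to the part of N inside the span of the
    remaining generators.\<close>
  have "ideal (N \<inter> ?M) R"
    using i_intersect Cons.prems(2) M(1) by blast
  from Cons.IH[OF xs this] M(2) Cons.prems
  obtain us vs where uv: "set us \<subseteq> ?M" "set vs \<subseteq> N \<inter> ?M" "?M \<subseteq> lspan R (carrier R) (N \<inter> ?M) us"
    "N \<inter> ?M \<subseteq> lspan R (carrier R) P vs" "length us + length vs \<le> length xs"
    by auto
  have us: "ideal (lspan R (carrier R) N us) R" "N \<subseteq> lspan R (carrier R) N us"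
    using lspan_ideal[OF Cons.prems(2), of us] uv(1) M.a_subset by auto
  have Mus: "?M \<subseteq> lspan R (carrier R) N us"
    using uv(3) lspan_mono[of "N \<inter> ?M" N R "carrier R" us] by blast
  show ?case
  proof (cases "N \<subseteq> ?M")
    case True
    then have "N \<inter> ?M = N" by blast
    then have "?M1 \<subseteq> lspan R (carrier R) N (x # us)" "N \<subseteq> lspan R (carrier R) P vs"
      using uv by auto
    then show ?thesis
      using uv MM1 M1(2) by (intro exI[of _ "x # us"] exI[of _ vs]) auto
  next
    case False
    then obtain z where z: "z \<in> N" "z \<notin> ?M" by blast
    then obtain r where r: "r \<in> carrier R" "z \<ominus> r \<otimes> x \<in> ?M" "z \<in> carrier R"
      using Cons.prems(4) by auto
    have "r \<notin> m"
    proof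
      assume "r \<in> m"
      then have "r \<otimes> x \<in> ?M"
        using Cons.prems(5) M(2) by auto
      then show False
        using M.minus_mem_cancel r z by blast
    qed
    then obtain s where s: "s \<in> carrier R" "\<one> \<ominus> s \<otimes> r \<in> m"
      using inverse_mod_m r(1) by blast
    have sx: "(\<one> \<ominus> s \<otimes> r) \<otimes> x \<in> ?M"
      using s Cons.prems(5) M(2) by auto
    \<comment> \<open>Modulo \<open>?M\<close>, z equals r x, and s r acts on x as 1, so x equals s
      z: a coefficient c of x becomes the coefficient c s of z.\<close>
    have exch: "y \<ominus> (c \<otimes> s) \<otimes> z \<in> ?M" if "y \<in> carrier R" "c \<in> carrier R" "y \<ominus> c \<otimes> x \<in> ?M" for y c
    proof -
      have "y \<ominus> (c \<otimes> s) \<otimes> z =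
        ((y \<ominus> c \<otimes> x) \<oplus> c \<otimes> ((\<one> \<ominus> s \<otimes> r) \<otimes> x)) \<ominus> (c \<otimes> s) \<otimes> (z \<ominus> r \<otimes> x)"
        using that x r s by algebra
      then show ?thesis
        using that sx r s M.I_l_closed by (simp add: M.minus_closed_I)
    qed
    have "N \<subseteq> lspan R (carrier R) P (z # vs)"
    proof
      fix n assume n: "n \<in> N"
      then obtain c where c: "c \<in> carrier R" "n \<ominus> c \<otimes> x \<in> ?M" "n \<in> carrier R"
        using Cons.prems(4) by auto
      have "n \<ominus> (c \<otimes> s) \<otimes> z \<in> N \<inter> ?M"
        using exch[OF c(3,1,2)] n z c s N.I_l_closed N.minus_closed_I by auto
      then show "n \<in> lspan R (carrier R) P (z # vs)"
        using uv(4) c s by auto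
    qed
    moreover have "?M1 \<subseteq> lspan R (carrier R) N us"
    proof
      fix y assume "y \<in> ?M1"
      then obtain c where c: "c \<in> carrier R" "y \<ominus> c \<otimes> x \<in> ?M" "y \<in> carrier R"
        by auto
      have "y \<ominus> (c \<otimes> s) \<otimes> z \<in> lspan R (carrier R) N us"
        using exch[OF c(3,1,2)] Mus by blast
      moreover have "(c \<otimes> s) \<otimes> z \<in> lspan R (carrier R) N us"
        using us z c s N.I_l_closed by auto
      ultimately show "y \<in> lspan R (carrier R) N us"
        using ideal.minus_mem_cancel[OF us(1)] c(3) by blast
    qed
    ultimately show ?thesis
      using uv z MM1 by (intro exI[of _ us] exI[of _ "z # vs"]) auto
  qed
qed

text \<open>As m M lies in P, all three quotients are vector spaces over the residue field, and this
  is additivity of dimension. Concatenating spanning lists gives one inequality, splitting a minimal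
  list by \<open>lspan_split\<close> the other.\<close>

lemma rank_add:
  assumes P: "ideal P R" and N: "ideal N R" and M: "ideal M R" and sub: "P \<subseteq> N" "N \<subseteq> M"
    and mM: "\<And>t x. \<lbrakk>t \<in> m; x \<in> M\<rbrakk> \<Longrightarrow> t \<otimes> x \<in> P"
  shows "rank M P = rank M N + rank N P"
proof (rule antisym)
  obtain us where us: "length us = rank M N" "set us \<subseteq> M" "M \<subseteq> lspan R (carrier R) N us"
    using rank_obtain[OF M N] .
  obtain vs where vs: "length vs = rank N P" "set vs \<subseteq> N" "N \<subseteq> lspan R (carrier R) P vs"
    using rank_obtain[OF N P] .
  have "M \<subseteq> lspan R (carrier R) P (us @ vs)"
    unfolding lspan_append using us(3) lspan_mono[OF vs(3), of R "carrier R" us] by blast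
  then show "rank M P \<le> rank M N + rank N P"
    using rank_le[of "us @ vs" M P] us vs sub by auto
next
  obtain xs where xs: "length xs = rank M P" "set xs \<subseteq> M" "M \<subseteq> lspan R (carrier R) P xs"
    using rank_obtain[OF M P] .
  have eq: "lspan R (carrier R) P xs = M"
    using xs lspan_subset_ideal[OF M _ xs(2), of P] sub by blast
  have "set xs \<subseteq> carrier R"
    using xs M additive_subgroup.a_subset ideal.axioms(1) by blast
  moreover have "t \<otimes> x \<in> P" if "t \<in> m" "x \<in> set xs" for t x
    using that mM xs(2) by blast
  ultimately obtain us vs where "set us \<subseteq> M" "set vs \<subseteq> N" "M \<subseteq> lspan R (carrier R) N us"
    "N \<subseteq> lspan R (carrier R) P vs" "length us + length vs \<le> length xs"
    using lspan_split[OF P _ N sub(1), of xs] sub eq by auto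
  then show "rank M N + rank N P \<le> rank M P"
    using rank_le[of us M N] rank_le[of vs N P] xs(1) by linarith
qed

end

subsection \<open>The associated graded ring\<close>

text \<open>Elements of gr are handled through sequences of representatives; \<open>x n\<close> is
  meant to lie in the n-th power.\<close>

definition gr_class :: "('a, 'b) ring_scheme \<Rightarrow> 'a set \<Rightarrow> (nat \<Rightarrow> 'a) \<Rightarrow> nat \<Rightarrow> 'a set" where
  "gr_class R I x = (\<lambda>n. ideal_pow R I (Suc n) +>\<^bsub>R\<^esub> x n)"

text \<open>The associated graded ring is the image of the following subring of the polynomial ring under
  \<open>gr_class\<close>; its ring axioms are inherited from there.\<close>

definition rees :: "('a, 'b) ring_scheme \<Rightarrow> 'a set \<Rightarrow> (nat \<Rightarrow> 'a) set" where
  "rees R I = {x \<in> up R. \<forall>n. x n \<in> ideal_pow R I n}"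

text \<open>The homogeneous element of degree d represented by x. For x in the d-th power but not in
  the next one it is the initial form of x.\<close>

definition gr_hom :: "('a, 'b) ring_scheme \<Rightarrow> 'a set \<Rightarrow> nat \<Rightarrow> 'a \<Rightarrow> nat \<Rightarrow> 'a set" where
  "gr_hom R I d x = gr_class R I (\<lambda>n. if n = d then x else \<zero>\<^bsub>R\<^esub>)"

locale comm_ideal = ideal I R + cring R for I and R (structure)
begin

abbreviation ipow :: "nat \<Rightarrow> 'a set" where "ipow \<equiv> ideal_pow R I"
abbreviation cls :: "(nat \<Rightarrow> 'a) \<Rightarrow> nat \<Rightarrow> 'a set" where "cls \<equiv> gr_class R I"
abbreviation hom_el :: "nat \<Rightarrow> 'a \<Rightarrow> nat \<Rightarrow> 'a set" where "hom_el \<equiv> gr_hom R I"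
abbreviation G where "G \<equiv> gr R I"

lemma pow_ideal: "ideal (ipow n) R"
  by (induction n) (auto intro: oneideal ideal_prod_is_ideal is_ideal)

lemma pow_carrier: "x \<in> ipow n \<Longrightarrow> x \<in> carrier R"
  using ideal.Icarr[OF pow_ideal] .

lemma pow_zero [simp]: "\<zero> \<in> ipow n"
  by (rule additive_subgroup.zero_closed[OF ideal.axioms(1)[OF pow_ideal]])

lemma pow_add: "\<lbrakk>x \<in> ipow n; y \<in> ipow n\<rbrakk> \<Longrightarrow> x \<oplus> y \<in> ipow n"
  by (rule additive_subgroup.a_closed[OF ideal.axioms(1)[OF pow_ideal]])

lemma pow_minus: "\<lbrakk>x \<in> ipow n; y \<in> ipow n\<rbrakk> \<Longrightarrow> x \<ominus> y \<in> ipow n"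
  using ideal.minus_closed_I[OF pow_ideal] .

lemma pow_Suc_subset: "ipow (Suc n) \<subseteq> ipow n"
  using ideal_prod_inter[OF is_ideal pow_ideal[of n]] by auto

lemma pow_antimono: "i \<le> j \<Longrightarrow> ipow j \<subseteq> ipow i"
  by (rule lift_Suc_antimono_le[of ipow]) (rule pow_Suc_subset)

lemma pow_mult: "\<lbrakk>x \<in> ipow i; y \<in> ipow j\<rbrakk> \<Longrightarrow> x \<otimes> y \<in> ipow (i + j)"
proof (induction i arbitrary: x)
  case 0
  then show ?case
    using ideal.I_l_closed[OF pow_ideal] by simp
next
  case (Suc i)
  have "y \<in> carrier R" using Suc.prems pow_carrier by blast
  have "x \<in> ideal_prod R I (ipow i)" using Suc.prems by simp
  then show ?case
  proof (induction x rule: ideal_prod.induct)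
    case (prod s t)
    then have "s \<otimes> (t \<otimes> y) \<in> ipow (Suc i + j)"
      using Suc by (auto intro: ideal_prod.prod)
    then show ?case
      using prod \<open>y \<in> carrier R\<close> pow_carrier by (simp add: m_assoc del: ideal_pow.simps)
  next
    case (sum s t)
    then have "s \<in> carrier R" "t \<in> carrier R"
      using pow_carrier[of _ "Suc i"] by auto
    then show ?case
      using sum \<open>y \<in> carrier R\<close> by (simp add: l_distr pow_add del: ideal_pow.simps)
  qed
qed

lemma pow_one: "ipow (Suc 0) = I"
proof
  show "ipow (Suc 0) \<subseteq> I"
    using ideal_prod_inter[OF is_ideal oneideal] by auto
  show "I \<subseteq> ipow (Suc 0)"
  proof
    fix x assume "x \<in> I"
    then have "x \<otimes> \<one> \<in> ideal_prod R I (carrier R)"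
      by (intro ideal_prod.prod) auto
    then show "x \<in> ipow (Suc 0)"
      using \<open>x \<in> I\<close> by simp
  qed
qed

declare ideal_pow.simps(2) [simp del]

lemma coset_eq_iff:
  assumes "x \<in> carrier R" "y \<in> carrier R"
  shows "ipow n +> x = ipow n +> y \<longleftrightarrow> x \<ominus> y \<in> ipow n"
  using quotient_eq_iff_same_a_r_cos[OF pow_ideal assms] by simp

lemma coset_zero: "ipow n +> \<zero> = ipow n"
  using a_rcos_zero[OF pow_ideal, of \<zero>] by simp

lemma coset_eq_pow_iff:
  assumes "x \<in> carrier R"
  shows "ipow n +> x = ipow n \<longleftrightarrow> x \<in> ipow n"
  using coset_eq_iff[OF assms zero_closed] coset_zero assms by (simp add: a_minus_def)

lemma some_rep_coset:
  assumes "x \<in> carrier R"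
  shows "some_rep (ipow n +> x) \<in> carrier R" "some_rep (ipow n +> x) \<ominus> x \<in> ipow n"
proof -
  interpret P: ideal "ipow n" R by (rule pow_ideal)
  have "some_rep (ipow n +> x) \<in> ipow n +> x"
    unfolding some_rep_def using P.a_rcos_self[OF assms] by (rule someI)
  then show "some_rep (ipow n +> x) \<in> carrier R" "some_rep (ipow n +> x) \<ominus> x \<in> ipow n"
    using assms P.a_elemrcos_carrier P.a_rcos_module_minus[OF ring_axioms assms] by blast+
qed

lemma some_rep_coset_pow:
  assumes "x \<in> ipow n"
  shows "some_rep (ipow (Suc n) +> x) \<in> ipow n"
proof (rule ideal.minus_mem_cancel[OF pow_ideal _ assms])
  show "some_rep (ipow (Suc n) +> x) \<in> carrier R"
    using some_rep_coset(1) pow_carrier[OF assms] .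
  show "some_rep (ipow (Suc n) +> x) \<ominus> x \<in> ipow n"
    using some_rep_coset(2)[OF pow_carrier[OF assms], of "Suc n"] pow_Suc_subset by blast
qed

lemma finsum_cong_mod:
  assumes "ideal J R" "finite A" "f \<in> A \<rightarrow> carrier R" "g \<in> A \<rightarrow> carrier R"
    and "\<And>i. i \<in> A \<Longrightarrow> f i \<ominus> g i \<in> J"
  shows "finsum R f A \<ominus> finsum R g A \<in> J"
  using assms(2-)
proof (induction A rule: finite_induct)
  case empty
  then show ?case
    using additive_subgroup.zero_closed[OF ideal.axioms(1)[OF assms(1)]] by (simp add: a_minus_def)
next
  case (insert i A)
  have c: "f i \<in> carrier R" "g i \<in> carrier R" "finsum R f A \<in> carrier R" "finsum R g A \<in> carrier R"
    using insert by auto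
  have "(f i \<oplus> finsum R f A) \<ominus> (g i \<oplus> finsum R g A) =
    (f i \<ominus> g i) \<oplus> (finsum R f A \<ominus> finsum R g A)"
    using c by algebra
  moreover have "\<dots> \<in> J"
    using insert additive_subgroup.a_closed[OF ideal.axioms(1)[OF assms(1)]] by auto
  ultimately show ?case
    using insert by simp
qed

text \<open>The choices made by \<open>some_rep\<close> in the product are harmless: changing
  factors of degrees i and n - i by elements one power higher changes their product only within the
  power n + 1.\<close>

lemma cls_mult:
  assumes x: "\<And>n. x n \<in> ipow n" and y: "\<And>n. y n \<in> ipow n"
  shows "cls x \<otimes>\<^bsub>G\<^esub> cls y = cls (\<lambda>n. \<Oplus>i\<in>{..n}. x i \<otimes> y (n - i))"
proof
  fix n
  let ?r = "\<lambda>i. some_rep (cls x i)" and ?s = "\<lambda>i. some_rep (cls y i)"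
  have r: "?r i \<in> ipow i" "?r i \<ominus> x i \<in> ipow (Suc i)"
    and s: "?s i \<in> ipow i" "?s i \<ominus> y i \<in> ipow (Suc i)" for i
    using some_rep_coset_pow[OF x] some_rep_coset_pow[OF y]
      some_rep_coset(2)[OF pow_carrier[OF x]] some_rep_coset(2)[OF pow_carrier[OF y]]
    by (auto simp: gr_class_def)
  have c: "x i \<in> carrier R" "y i \<in> carrier R" "?r i \<in> carrier R" "?s i \<in> carrier R" for i
    using x y r s pow_carrier by blast+
  have "(\<Oplus>i\<in>{..n}. ?r i \<otimes> ?s (n - i)) \<ominus> (\<Oplus>i\<in>{..n}. x i \<otimes> y (n - i)) \<in> ipow (Suc n)"
  proof (rule finsum_cong_mod[OF pow_ideal])
    fix i assume i: "i \<in> {..n}"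
    have "?r i \<otimes> ?s (n - i) \<ominus> x i \<otimes> y (n - i) =
      ?r i \<otimes> (?s (n - i) \<ominus> y (n - i)) \<oplus> (?r i \<ominus> x i) \<otimes> y (n - i)"
      using c[of i] c[of "n - i"] by algebra
    moreover have "?r i \<otimes> (?s (n - i) \<ominus> y (n - i)) \<in> ipow (Suc n)"
      using pow_mult[OF r(1)[of i] s(2)[of "n - i"]] i by simp
    moreover have "(?r i \<ominus> x i) \<otimes> y (n - i) \<in> ipow (Suc n)"
      using pow_mult[OF r(2)[of i] y[of "n - i"]] i by simp
    ultimately show "?r i \<otimes> ?s (n - i) \<ominus> x i \<otimes> y (n - i) \<in> ipow (Suc n)"
      using pow_add by simp
  qed (use c in auto)
  moreover have "(\<Oplus>i\<in>{..n}. ?r i \<otimes> ?s (n - i)) \<in> carrier R" "(\<Oplus>i\<in>{..n}. x i \<otimes> y (n - i)) \<in> carrier R"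
    using c by (auto intro: finsum_closed)
  ultimately have "ipow (Suc n) +> (\<Oplus>i\<in>{..n}. ?r i \<otimes> ?s (n - i)) =
    ipow (Suc n) +> (\<Oplus>i\<in>{..n}. x i \<otimes> y (n - i))"
    using coset_eq_iff by blast
  then show "(cls x \<otimes>\<^bsub>G\<^esub> cls y) n = cls (\<lambda>n. \<Oplus>i\<in>{..n}. x i \<otimes> y (n - i)) n"
    by (simp add: gr_def gr_class_def)
qed

lemma cls_add:
  assumes "\<And>n. x n \<in> carrier R" "\<And>n. y n \<in> carrier R"
  shows "cls x \<oplus>\<^bsub>G\<^esub> cls y = cls (\<lambda>n. x n \<oplus> y n)"
  using ideal.a_rcos_sum[OF pow_ideal] assms by (simp add: gr_def gr_class_def)

lemma gr_one: "\<one>\<^bsub>G\<^esub> = hom_el 0 \<one>"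
  by (simp add: gr_def gr_hom_def gr_class_def coset_zero fun_eq_iff)

lemma gr_zero: "\<zero>\<^bsub>G\<^esub> = cls (\<lambda>_. \<zero>)"
  by (simp add: gr_def gr_class_def coset_zero)

lemma cls_eq_iff:
  assumes "\<And>n. x n \<in> carrier R" "\<And>n. y n \<in> carrier R"
  shows "cls x = cls y \<longleftrightarrow> (\<forall>n. x n \<ominus> y n \<in> ipow (Suc n))"
  using coset_eq_iff assms by (simp add: gr_class_def fun_eq_iff)

lemma cls_eq_zero_iff:
  assumes "\<And>n. x n \<in> carrier R"
  shows "cls x = \<zero>\<^bsub>G\<^esub> \<longleftrightarrow> (\<forall>n. x n \<in> ipow (Suc n))"
  using coset_eq_pow_iff assms by (simp add: gr_class_def fun_eq_iff gr_def)

section \<open>Representing sequences of finite support and the ring axioms for gr\<close>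

lemma reesD: "x \<in> rees R I \<Longrightarrow> x n \<in> ipow n" "x \<in> rees R I \<Longrightarrow> x n \<in> carrier R"
  using pow_carrier by (auto simp: rees_def)

lemma reesI:
  assumes "\<And>n. x n \<in> ipow n" "\<And>n. n > N \<Longrightarrow> x n = \<zero>"
  shows "x \<in> rees R I"
proof -
  have "bound \<zero> N x"
    using assms(2) by unfold_locales
  then show ?thesis
    using assms(1) pow_carrier unfolding rees_def by (blast intro: mem_upI)
qed

lemma rees_bound:
  assumes "x \<in> rees R I"
  obtains N where "\<And>n. n > N \<Longrightarrow> x n = \<zero>"
proof -
  obtain N where "bound \<zero> N x"
    using assms bound_upD unfolding rees_def by blast
  then show ?thesis
    using that[of N] bound.bound by metis
qed

lemma carrier_gr: "carrier G = cls ` rees R I"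
proof (intro equalityI subsetI)
  fix f assume f: "f \<in> carrier G"
  then have "\<forall>n. \<exists>x\<in>ipow n. f n = ipow (Suc n) +> x"
    by (simp add: gr_def)
  then obtain X where X: "\<And>n. X n \<in> ipow n" "\<And>n. f n = ipow (Suc n) +> X n"
    by metis
  have "finite {n. f n \<noteq> ipow (Suc n)}"
    using f by (simp add: gr_def)
  then obtain N where N: "\<And>n. f n \<noteq> ipow (Suc n) \<Longrightarrow> n \<le> N"
    using finite_nat_set_iff_bounded_le by auto
  \<comment> \<open>Representatives of zero components are reset to 0, so that the finite support of
    f passes to the sequence.\<close>
  let ?x = "\<lambda>n. if f n = ipow (Suc n) then \<zero> else X n"
  have "f = cls ?x"
    using X(2) by (simp add: gr_class_def coset_zero fun_eq_iff)
  moreover have "?x \<in> rees R I"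
    by (rule reesI[of _ N]) (use X(1) N in \<open>auto simp: not_le[symmetric]\<close>)
  ultimately show "f \<in> cls ` rees R I" by blast
next
  fix f assume "f \<in> cls ` rees R I"
  then obtain x where x: "x \<in> rees R I" "f = cls x" by blast
  obtain N where N: "\<And>n. n > N \<Longrightarrow> x n = \<zero>"
    using rees_bound[OF x(1)] by blast
  have "{n. f n \<noteq> ipow (Suc n)} \<subseteq> {..N}"
  proof
    fix n assume "n \<in> {n. f n \<noteq> ipow (Suc n)}"
    then have "x n \<noteq> \<zero>"
      using x(2) by (auto simp: gr_class_def coset_zero)
    then show "n \<in> {..N}"
      using N[of n] by force
  qed
  then have "finite {n. f n \<noteq> ipow (Suc n)}"
    by (rule finite_subset) simp
  then show "f \<in> carrier G"
    using x reesD by (auto simp: gr_def gr_class_def)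
qed

lemma rees_mult:
  assumes "x \<in> rees R I" "y \<in> rees R I"
  shows "(\<lambda>n. \<Oplus>i\<in>{..n}. x i \<otimes> y (n - i)) \<in> rees R I"
proof -
  have "(\<Oplus>i\<in>{..n}. x i \<otimes> y (n - i)) \<in> ipow n" for n
  proof -
    have "finsum R f A \<in> ipow n" if "finite A" "f \<in> A \<rightarrow> ipow n" for f and A :: "nat set"
      using that
    proof (induction A rule: finite_induct)
      case (insert i A)
      then have "f \<in> A \<rightarrow> carrier R" "f i \<in> carrier R"
        using pow_carrier by auto
      then show ?case
        using insert pow_add by simp
    qed simp
    moreover have "x i \<otimes> y (n - i) \<in> ipow n" if "i \<in> {..n}" for i
      using pow_mult[OF reesD(1)[OF assms(1), of i] reesD(1)[OF assms(2), of "n - i"]] that by simp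
    ultimately show ?thesis by simp
  qed
  then show ?thesis
    using up_mult_closed assms by (simp add: rees_def)
qed

lemma rees_subring: "subring (rees R I) (UP R)"
proof -
  interpret U: UP_cring R "UP R" by unfold_locales auto
  have carrier: "carrier (UP R) = up R" by (simp add: UP_def)
  have rees_up: "x \<in> up R" if "x \<in> rees R I" for x
    using that by (simp add: rees_def)
  have inv: "\<ominus>\<^bsub>UP R\<^esub> x = (\<lambda>n. \<ominus> x n)" if "x \<in> up R" for x
  proof (rule U.up_eqI)
    show "coeff (UP R) (\<ominus>\<^bsub>UP R\<^esub> x) n = coeff (UP R) (\<lambda>n. \<ominus> x n) n" for n
      using that up_a_inv_closed[OF that] U.coeff_a_inv[of x n] by (simp add: UP_def)
    show "\<ominus>\<^bsub>UP R\<^esub> x \<in> carrier (UP R)"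
      using abelian_group.a_inv_closed[OF ring.is_abelian_group[OF U.UP_ring]] that carrier by simp
  qed (use up_a_inv_closed[OF that] carrier in auto)
  have neg: "(\<lambda>n. \<ominus> x n) \<in> rees R I" if "x \<in> rees R I" for x
    using that up_a_inv_closed[of x] pow_ideal
    by (auto simp: rees_def additive_subgroup.a_inv_closed ideal.axioms(1))
  show ?thesis
  proof (rule ring.subringI)
    show "ring (UP R)" by (rule U.UP_ring)
    show "rees R I \<subseteq> carrier (UP R)"
      unfolding carrier using rees_up by blast
    show "\<one>\<^bsub>UP R\<^esub> \<in> rees R I"
      by (auto simp: UP_def intro!: reesI[of _ 0])
    fix x y assume xy: "x \<in> rees R I" "y \<in> rees R I"
    show "\<ominus>\<^bsub>UP R\<^esub> x \<in> rees R I"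
      using xy neg inv rees_up by simp
    show "x \<otimes>\<^bsub>UP R\<^esub> y \<in> rees R I"
      using xy rees_mult rees_up by (simp add: UP_def)
    show "x \<oplus>\<^bsub>UP R\<^esub> y \<in> rees R I"
    proof -
      have "x \<oplus>\<^bsub>UP R\<^esub> y = (\<lambda>n. x n \<oplus> y n)"
        using rees_up[OF xy(1)] rees_up[OF xy(2)] by (simp add: UP_def)
      moreover have "(\<lambda>n. x n \<oplus> y n) \<in> up R"
        using up_add_closed rees_up xy by blast
      ultimately show ?thesis
        using pow_add reesD(1)[OF xy(1)] reesD(1)[OF xy(2)] by (auto simp: rees_def)
    qed
  qed
qed

text \<open>\<open>cls\<close> maps a commutative subring of the polynomial ring homomorphically
  onto gr, so the axioms carry over to the image.\<close>

lemma cring_gr: "cring G"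
proof -
  interpret U: UP_cring R "UP R" by unfold_locales auto
  let ?T = "UP R \<lparr>carrier := rees R I\<rparr>"
  have "cring (UP R)" by (rule U.UP_cring)
  then have T: "cring ?T"
    using cring.subcringI'[OF _ rees_subring] ring.subcring_iff[of "UP R" "rees R I"]
      subringE(1)[OF rees_subring] U.UP_ring by blast
  interpret T: cring ?T by (rule T)
  have up: "x \<in> up R" if "x \<in> rees R I" for x
    using that by (simp add: rees_def)
  have hom: "cls \<in> ring_hom ?T G"
  proof (rule ring_hom_memI)
    show "cls x \<in> carrier G" if "x \<in> carrier ?T" for x
      using that carrier_gr by simp
    show "cls (x \<otimes>\<^bsub>?T\<^esub> y) = cls x \<otimes>\<^bsub>G\<^esub> cls y" "cls (x \<oplus>\<^bsub>?T\<^esub> y) = cls x \<oplus>\<^bsub>G\<^esub> cls y"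
      if "x \<in> carrier ?T" "y \<in> carrier ?T" for x y
      using that up reesD cls_mult[of x y] cls_add[of x y] by (auto simp: UP_def)
    show "cls \<one>\<^bsub>?T\<^esub> = \<one>\<^bsub>G\<^esub>"
      by (simp add: UP_def gr_one gr_hom_def)
  qed
  \<comment> \<open>The image ring is \<open>G\<close> with carrier and zero overwritten, here by
    the values that \<open>G\<close> already has.\<close>
  have "G \<lparr>carrier := cls ` carrier ?T, zero := cls \<zero>\<^bsub>?T\<^esub>\<rparr> = G"
    using carrier_gr gr_zero by (simp add: UP_def)
  then interpret G: ring G
    using T.ring_hom_imp_img_ring[OF hom] by simp
  have "f \<otimes>\<^bsub>G\<^esub> g = g \<otimes>\<^bsub>G\<^esub> f" if "f \<in> carrier G" "g \<in> carrier G" for f g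
  proof -
    obtain x y where "x \<in> carrier ?T" "y \<in> carrier ?T" "f = cls x" "g = cls y"
      using \<open>f \<in> carrier G\<close> \<open>g \<in> carrier G\<close> carrier_gr by auto
    then show ?thesis
      using ring_hom_mult[OF hom, of x y] ring_hom_mult[OF hom, of y x] T.m_comm[of x y] by simp
  qed
  then show ?thesis
    by unfold_locales
qed

section \<open>Homogeneous elements and divisibility by them\<close>

lemma hom_seq_pow: "x \<in> ipow d \<Longrightarrow> (if n = d then x else \<zero>) \<in> ipow n"
  by simp

lemma hom_seq_rees: "x \<in> ipow d \<Longrightarrow> (\<lambda>n. if n = d then x else \<zero>) \<in> rees R I"
  by (rule reesI[of _ d]) auto

lemma hom_el_carrier: "x \<in> ipow d \<Longrightarrow> hom_el d x \<in> carrier G"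
  by (simp add: carrier_gr gr_hom_def hom_seq_rees)

text \<open>Only the summand i = d of the convolution survives, so the factor multiplies by a and
  shifts degrees by d.\<close>

lemma hom_el_mult_cls:
  assumes a: "a \<in> ipow d" and x: "\<And>n. x n \<in> ipow n"
  shows "hom_el d a \<otimes>\<^bsub>G\<^esub> cls x = cls (\<lambda>n. if n < d then \<zero> else a \<otimes> x (n - d))"
proof -
  have c: "a \<in> carrier R" "x n \<in> carrier R" for n
    using a x pow_carrier by blast+
  have "(\<Oplus>i\<in>{..n}. (if i = d then a else \<zero>) \<otimes> x (n - i)) = (if n < d then \<zero> else a \<otimes> x (n - d))" for n
  proof -
    have "(\<Oplus>i\<in>{..n}. (if i = d then a else \<zero>) \<otimes> x (n - i)) =
      (\<Oplus>i\<in>{..n}. if d = i then a \<otimes> x (n - i) else \<zero>)"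
      using c by (intro finsum_cong') auto
    also have "\<dots> = (if n < d then \<zero> else a \<otimes> x (n - d))"
    proof (cases "n < d")
      case True
      then have "(\<Oplus>i\<in>{..n}. if d = i then a \<otimes> x (n - i) else \<zero>) = (\<Oplus>i\<in>{..n}. \<zero>)"
        by (intro finsum_cong') auto
      then show ?thesis using True by simp
    next
      case False
      then show ?thesis
        using c finsum_singleton[of d "{..n}" "\<lambda>i. a \<otimes> x (n - i)"] by simp
    qed
    finally show ?thesis .
  qed
  then show ?thesis
    unfolding gr_hom_def using cls_mult[OF hom_seq_pow[OF a] x] by simp
qed

lemma hom_el_add:
  assumes "x \<in> carrier R" "y \<in> carrier R"
  shows "hom_el d x \<oplus>\<^bsub>G\<^esub> hom_el d y = hom_el d (x \<oplus> y)"
proof -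
  have "hom_el d x \<oplus>\<^bsub>G\<^esub> hom_el d y =
    cls (\<lambda>n. (if n = d then x else \<zero>) \<oplus> (if n = d then y else \<zero>))"
    unfolding gr_hom_def using assms by (intro cls_add) auto
  also have "(\<lambda>n. (if n = d then x else \<zero>) \<oplus> (if n = d then y else \<zero>)) = (\<lambda>n. if n = d then x \<oplus> y else \<zero>)"
    by auto
  finally show ?thesis
    by (simp add: gr_hom_def)
qed

lemma hom_el_minus:
  assumes "x \<in> ipow d" "y \<in> ipow d"
  shows "hom_el d x \<ominus>\<^bsub>G\<^esub> hom_el d y = hom_el d (x \<ominus> y)"
proof -
  interpret G: cring G by (rule cring_gr)
  have c: "x \<in> carrier R" "y \<in> carrier R"
    using assms pow_carrier by blast+
  have "(x \<ominus> y) \<oplus> y = x"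
    using c by algebra
  then have eq: "hom_el d x = hom_el d (x \<ominus> y) \<oplus>\<^bsub>G\<^esub> hom_el d y"
    using hom_el_add[of "x \<ominus> y" y d] c by simp
  have "hom_el d (x \<ominus> y) \<in> carrier G" "hom_el d y \<in> carrier G"
    using assms pow_minus hom_el_carrier by blast+
  then show ?thesis
    unfolding eq by (simp add: G.minus_eq G.a_assoc G.r_neg)
qed

lemma hom_el_mult:
  assumes "c \<in> carrier R" "x \<in> ipow d"
  shows "hom_el 0 c \<otimes>\<^bsub>G\<^esub> hom_el d x = hom_el d (c \<otimes> x)"
proof -
  have "hom_el 0 c \<otimes>\<^bsub>G\<^esub> hom_el d x = cls (\<lambda>n. c \<otimes> (if n = d then x else \<zero>))"
    unfolding gr_hom_def[of R I d] using hom_el_mult_cls[OF _ hom_seq_pow[OF assms(2)], of c 0] assms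
    by simp
  also have "(\<lambda>n. c \<otimes> (if n = d then x else \<zero>)) = (\<lambda>n. if n = d then c \<otimes> x else \<zero>)"
    using assms by auto
  finally show ?thesis
    by (simp add: gr_hom_def)
qed

lemma hom_el_eq_zero_iff:
  assumes "x \<in> carrier R"
  shows "hom_el d x = \<zero>\<^bsub>G\<^esub> \<longleftrightarrow> x \<in> ipow (Suc d)"
  unfolding gr_hom_def using assms by (subst cls_eq_zero_iff) auto

lemma gr_part_eq: "gr_part R I d = hom_el d ` ipow d"
proof (intro equalityI subsetI)
  fix f assume f: "f \<in> gr_part R I d"
  then obtain x where x: "x \<in> rees R I" "f = cls x"
    by (auto simp: gr_part_def carrier_gr)
  have "f = hom_el d (x d)"
  proof
    fix n show "f n = hom_el d (x d) n"
      using f x(2) by (auto simp: gr_part_def gr_hom_def gr_class_def coset_zero)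
  qed
  then show "f \<in> hom_el d ` ipow d"
    using reesD(1)[OF x(1)] by blast
next
  fix f assume "f \<in> hom_el d ` ipow d"
  then show "f \<in> gr_part R I d"
    using hom_el_carrier by (auto simp: gr_part_def gr_hom_def gr_class_def coset_zero)
qed

lemma gr_part_subset: "gr_part R I d \<subseteq> carrier G"
  by (auto simp: gr_part_def)

lemma initial_form_eq:
  assumes "a \<in> ipow d" "a \<notin> ipow (Suc d)"
  shows "initial_form R I a = hom_el d a"
proof -
  have "(GREATEST n. a \<in> ipow n) = d"
  proof (rule Greatest_equality)
    fix n assume "a \<in> ipow n"
    then show "n \<le> d"
      using assms(2) pow_antimono[of "Suc d" n] not_less_eq_eq by blast
  qed (rule assms(1))
  then show ?thesis
    by (auto simp: initial_form_def gr_hom_def gr_class_def coset_zero fun_eq_iff)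
qed

text \<open>Reduces membership in the principal ideal of a degree-one element to one divisibility
  condition per degree, modulo the next power. Serves both the annihilator and the kernel
  computation.\<close>

lemma cls_in_PIdl:
  assumes a: "a \<in> I" and x: "x \<in> rees R I" and x0: "x 0 \<in> I"
    and y: "\<And>n. \<exists>y\<in>ipow n. x (Suc n) \<ominus> a \<otimes> y \<in> ipow (Suc (Suc n))"
  shows "cls x \<in> PIdl\<^bsub>G\<^esub> (hom_el 1 a)"
proof -
  interpret G: cring G by (rule cring_gr)
  obtain N where N: "\<And>n. n > N \<Longrightarrow> x n = \<zero>"
    using rees_bound[OF x] by blast
  obtain Y where Y: "\<And>n. Y n \<in> ipow n" "\<And>n. x (Suc n) \<ominus> a \<otimes> Y n \<in> ipow (Suc (Suc n))"
    using y by metis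
  \<comment> \<open>The quotients chosen degree by degree need not vanish eventually. Cutting them
    off beyond N is harmless, since \<open>x (Suc n)\<close> is zero there.\<close>
  define y where "y = (\<lambda>n. if n > N then \<zero> else Y n)"
  have y: "y \<in> rees R I"
    by (rule reesI[of _ N]) (auto simp: y_def Y)
  have a1: "a \<in> ipow 1" "a \<in> carrier R"
    using a pow_one by auto
  have prod: "hom_el 1 a \<otimes>\<^bsub>G\<^esub> cls y = cls (\<lambda>n. if n < 1 then \<zero> else a \<otimes> y (n - 1))"
    by (rule hom_el_mult_cls[OF a1(1) reesD(1)[OF y]])
  have "x n \<ominus> (if n < 1 then \<zero> else a \<otimes> y (n - 1)) \<in> ipow (Suc n)" for n
  proof (cases n)
    case 0
    then show ?thesis
      using x0 pow_one reesD(2)[OF x, of 0] by (simp add: a_minus_def)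
  next
    case (Suc k)
    show ?thesis
    proof (cases "k > N")
      case True
      then show ?thesis
        using Suc N[of "Suc k"] a1 by (simp add: y_def a_minus_def)
    next
      case False
      then show ?thesis
        using Suc Y(2)[of k] by (simp add: y_def)
    qed
  qed
  then have "cls x = cls (\<lambda>n. if n < 1 then \<zero> else a \<otimes> y (n - 1))"
    using reesD(2)[OF x] reesD(2)[OF y] a1 by (subst cls_eq_iff) auto
  then have "cls x = cls y \<otimes>\<^bsub>G\<^esub> hom_el 1 a"
    using prod G.m_comm[of "hom_el 1 a" "cls y"] hom_el_carrier[OF a1(1)] y carrier_gr by auto
  then show ?thesis
    unfolding cgenideal_def using y carrier_gr by blast
qed

lemma local_rank_eq_rel_rank:
  "local_rank R I n = rel_rank R (carrier R) (ipow n) (ipow (Suc n))"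
proof -
  have *: "(\<forall>y \<in> ipow n. \<exists>c \<in> {..<length xs} \<rightarrow> carrier R.
        y \<ominus> (\<Oplus>i\<in>{..<length xs}. c i \<otimes> xs ! i) \<in> ipow (Suc n))
      \<longleftrightarrow> ipow n \<subseteq> lspan R (carrier R) (ipow (Suc n)) xs" if "set xs \<subseteq> ipow n" for xs
  proof -
    have "y \<in> lspan R (carrier R) (ipow (Suc n)) xs \<longleftrightarrow> (\<exists>c \<in> {..<length xs} \<rightarrow> carrier R.
        y \<ominus> (\<Oplus>i\<in>{..<length xs}. c i \<otimes> xs ! i) \<in> ipow (Suc n))" if "y \<in> ipow n" for y
      using that \<open>set xs \<subseteq> ipow n\<close> pow_carrier by (intro lspan_iff_finsum) blast+
    then show ?thesis
      unfolding subset_iff[of "ipow n"] Ball_def by simp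
  qed
  show ?thesis
    unfolding local_rank_def rel_rank_def
    by (intro arg_cong[where f = Least] ext) (use * in blast)
qed

end

subsection \<open>Functoriality along surjections\<close>

locale surj_gr = source: comm_ideal I R + target: comm_ideal J S + phi: ring_hom_cring R S \<phi>
  for I and R (structure) and J and S (structure) and \<phi> +
  assumes surj: "\<phi> ` carrier R = carrier S" and J_eq: "J = \<phi> ` I"
begin

lemma ideal_pow_image: "ideal_pow S J n = \<phi> ` ideal_pow R I n"
proof (induction n)
  case 0
  then show ?case using surj by simp
next
  case (Suc n)
  let ?P = "ideal_prod R I (ideal_pow R I n)"
  have carr: "x \<in> carrier R" if "x \<in> ?P" for x
    using that source.pow_carrier[of x "Suc n"] by (simp add: ideal_pow.simps)
  have "\<phi> x \<in> ideal_prod S J (ideal_pow S J n)" if "x \<in> ?P" for x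
    using that
  proof (induction x rule: ideal_prod.induct)
    case (prod i j)
    then have "\<phi> i \<otimes>\<^bsub>S\<^esub> \<phi> j \<in> ideal_prod S J (ideal_pow S J n)"
      using J_eq Suc by (intro ideal_prod.prod) auto
    then show ?case
      using prod source.pow_carrier source.Icarr by simp
  next
    case (sum s t)
    then show ?case
      using carr by (simp add: ideal_prod.sum)
  qed
  moreover have "y \<in> \<phi> ` ?P" if "y \<in> ideal_prod S J (ideal_pow S J n)" for y
    using that
  proof (induction y rule: ideal_prod.induct)
    case (prod i j)
    then obtain s t where st: "s \<in> I" "t \<in> ideal_pow R I n" "i = \<phi> s" "j = \<phi> t"
      using J_eq Suc by auto
    then have "\<phi> (s \<otimes> t) = i \<otimes>\<^bsub>S\<^esub> j"
      using source.pow_carrier source.Icarr by simp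
    then show ?case
      using ideal_prod.prod[OF st(1,2)] by (metis imageI)
  next
    case (sum s t)
    then obtain x y where xy: "x \<in> ?P" "y \<in> ?P" "s = \<phi> x" "t = \<phi> y"
      by auto
    then have "\<phi> (x \<oplus> y) = s \<oplus>\<^bsub>S\<^esub> t"
      using carr by simp
    then show ?case
      using ideal_prod.sum[OF xy(1,2)] by (metis imageI)
  qed
  ultimately show ?case
    by (auto simp: ideal_pow.simps)
qed

lemma phi_minus: "\<lbrakk>x \<in> carrier R; y \<in> carrier R\<rbrakk> \<Longrightarrow> \<phi> (x \<ominus> y) = \<phi> x \<ominus>\<^bsub>S\<^esub> \<phi> y"
  by (simp add: a_minus_def)

lemma phi_pow: "x \<in> ideal_pow R I n \<Longrightarrow> \<phi> x \<in> ideal_pow S J n"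
  by (simp add: ideal_pow_image)

abbreviation gmap where "gmap \<equiv> gr_map R I S J \<phi>"

text \<open>Independence of the representative picked in \<open>gr_map\<close>: phi carries I^(n+1)
  into J^(n+1), so all choices give the same coset.\<close>

lemma gr_map_cls:
  assumes "\<And>n. x n \<in> carrier R"
  shows "gmap (gr_class R I x) = gr_class S J (\<lambda>n. \<phi> (x n))"
proof
  fix n
  let ?r = "some_rep (ideal_pow R I (Suc n) +> x n)"
  have r: "?r \<in> carrier R" "?r \<ominus> x n \<in> ideal_pow R I (Suc n)"
    using source.some_rep_coset[OF assms] by blast+
  then have "\<phi> ?r \<ominus>\<^bsub>S\<^esub> \<phi> (x n) \<in> ideal_pow S J (Suc n)"
    using phi_pow phi_minus[OF r(1) assms] by metis
  then show "gmap (gr_class R I x) n = gr_class S J (\<lambda>n. \<phi> (x n)) n"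
    using r assms target.coset_eq_iff[of "\<phi> ?r" "\<phi> (x n)"] by (simp add: gr_map_def gr_class_def)
qed

lemma gr_map_hom_el:
  assumes "x \<in> carrier R"
  shows "gmap (gr_hom R I d x) = gr_hom S J d (\<phi> x)"
proof -
  have "(\<lambda>n. \<phi> (if n = d then x else \<zero>)) = (\<lambda>n. if n = d then \<phi> x else \<zero>\<^bsub>S\<^esub>)"
    by auto
  then show ?thesis
    unfolding gr_hom_def using assms gr_map_cls[of "\<lambda>n. if n = d then x else \<zero>"] by simp
qed

lemma rees_image: "x \<in> rees R I \<Longrightarrow> (\<lambda>n. \<phi> (x n)) \<in> rees S J"
proof -
  assume x: "x \<in> rees R I"
  then obtain N where "\<And>n. n > N \<Longrightarrow> x n = \<zero>"
    using source.rees_bound by blast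
  then show ?thesis
    using source.reesD(1)[OF x] phi_pow by (intro target.reesI[of _ N]) auto
qed

lemma gr_map_ring_hom: "gmap \<in> ring_hom (gr R I) (gr S J)"
proof (rule ring_hom_memI)
  show "gmap f \<in> carrier (gr S J)" if "f \<in> carrier (gr R I)" for f
    using that source.carrier_gr target.carrier_gr gr_map_cls source.reesD(2) rees_image by auto
  show "gmap \<one>\<^bsub>gr R I\<^esub> = \<one>\<^bsub>gr S J\<^esub>"
    unfolding source.gr_one target.gr_one by (simp add: gr_map_hom_el)
  fix f g assume "f \<in> carrier (gr R I)" "g \<in> carrier (gr R I)"
  then obtain x y where xy: "x \<in> rees R I" "f = gr_class R I x" "y \<in> rees R I" "g = gr_class R I y"
    using source.carrier_gr by auto
  note x = source.reesD[OF xy(1)] and y = source.reesD[OF xy(3)]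
  have "\<phi> (\<Oplus>i\<in>{..n}. x i \<otimes> y (n - i)) = (\<Oplus>\<^bsub>S\<^esub>i\<in>{..n}. \<phi> (x i) \<otimes>\<^bsub>S\<^esub> \<phi> (y (n - i)))" for n
    using x y phi.hom_finsum[of "\<lambda>i. x i \<otimes> y (n - i)" "{..n}"] by (simp add: Pi_def comp_def)
  then show "gmap (f \<otimes>\<^bsub>gr R I\<^esub> g) = gmap f \<otimes>\<^bsub>gr S J\<^esub> gmap g"
    using xy x y phi_pow source.rees_mult[OF xy(1,3)]
    by (simp add: source.cls_mult target.cls_mult gr_map_cls source.reesD(2))
  show "gmap (f \<oplus>\<^bsub>gr R I\<^esub> g) = gmap f \<oplus>\<^bsub>gr S J\<^esub> gmap g"
    using xy x y by (simp add: source.cls_add target.cls_add gr_map_cls)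
qed

lemma gr_map_part: "gmap ` gr_part R I n = gr_part S J n"
proof -
  have "gmap (gr_hom R I n x) = gr_hom S J n (\<phi> x)" if "x \<in> ideal_pow R I n" for x
    using gr_map_hom_el source.pow_carrier that by blast
  then show ?thesis
    unfolding source.gr_part_eq target.gr_part_eq ideal_pow_image by (force simp: image_image)
qed

lemma gr_map_surj: "gmap ` carrier (gr R I) = carrier (gr S J)"
proof
  show "gmap ` carrier (gr R I) \<subseteq> carrier (gr S J)"
    using ring_hom_memE(1)[OF gr_map_ring_hom] by blast
  show "carrier (gr S J) \<subseteq> gmap ` carrier (gr R I)"
  proof
    fix g assume "g \<in> carrier (gr S J)"
    then obtain y where y: "y \<in> rees S J" "g = gr_class S J y"
      using target.carrier_gr by auto
    obtain N where N: "\<And>n. n > N \<Longrightarrow> y n = \<zero>\<^bsub>S\<^esub>"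
      using target.rees_bound[OF y(1)] by blast
    have "\<forall>n. \<exists>x\<in>ideal_pow R I n. \<phi> x = y n"
      using target.reesD(1)[OF y(1)] ideal_pow_image by (metis imageE)
    then obtain X where X: "\<And>n. X n \<in> ideal_pow R I n" "\<And>n. \<phi> (X n) = y n"
      by metis
    \<comment> \<open>A lift of zero need not be zero, so the lifts beyond the support of y are
      reset to 0.\<close>
    let ?x = "\<lambda>n. if n > N then \<zero> else X n"
    have x: "?x \<in> rees R I"
      by (rule source.reesI[of _ N]) (use X in auto)
    have "gmap (gr_class R I ?x) = g"
      using gr_map_cls[of ?x] source.reesD(2)[OF x] X N y(2)
      by (auto intro!: arg_cong[where f = "gr_class S J"])
    then show "g \<in> gmap ` carrier (gr R I)"
      using x source.carrier_gr by blast
  qed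
qed

lemma gr_map_ring_hom_ring: "ring_hom_ring (gr R I) (gr S J) gmap"
  by (rule ring_hom_ringI2[OF cring.axioms(1)[OF source.cring_gr]
      cring.axioms(1)[OF target.cring_gr] gr_map_ring_hom])

lemma rank_image:
  assumes M: "ideal M R" and N: "\<And>x. x \<in> M \<Longrightarrow> \<phi> x \<in> N' \<longleftrightarrow> x \<in> N"
  shows "rel_rank R (carrier R) M N = rel_rank S (carrier S) (\<phi> ` M) N'"
proof (rule rel_rank_transfer[where f = \<phi> and g = \<phi>])
  interpret M: ideal M R by (rule M)
  show "M \<subseteq> carrier R" by (rule M.a_subset)
  show "x \<ominus> c \<otimes> y \<in> M" if "x \<in> M" "y \<in> M" "c \<in> carrier R" for x y c
    using that M.minus_closed_I M.I_l_closed by blast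
  show "\<phi> (x \<ominus> c \<otimes> y) = \<phi> x \<ominus>\<^bsub>S\<^esub> \<phi> c \<otimes>\<^bsub>S\<^esub> \<phi> y" if "x \<in> M" "y \<in> M" "c \<in> carrier R" for x y c
    using that phi_minus M.a_subset by (simp add: M.Icarr)
  show "\<phi> ` M \<subseteq> carrier S"
    using M.a_subset by auto
qed (use surj N in auto)

abbreviation K where "K \<equiv> a_kernel (gr R I) (gr S J) gmap"

lemma kernel_gr_map_iff: "f \<in> K \<longleftrightarrow> f \<in> carrier (gr R I) \<and> gmap f = \<zero>\<^bsub>gr S J\<^esub>"
  unfolding a_kernel_def' by blast

lemma hom_el_kernel_iff:
  assumes "x \<in> ideal_pow R I n"
  shows "gr_hom R I n x \<in> K \<longleftrightarrow> \<phi> x \<in> ideal_pow S J (Suc n)"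
  using assms source.pow_carrier source.hom_el_carrier gr_map_hom_el[of x n]
    target.hom_el_eq_zero_iff[of "\<phi> x" n] by (simp add: kernel_gr_map_iff)

text \<open>The degree-n part of gr(R)/K is I^n modulo the x with phi x in J^(n+1), and phi
  identifies this with J^n/J^(n+1). Each identification is a rank transfer; in the first one a
  scalar c of R corresponds to its class in degree 0.\<close>

lemma graded_rank_quot:
  "graded_rank (gr R I Quot K) (\<lambda>n. (\<lambda>f. K +>\<^bsub>gr R I\<^esub> f) ` gr_part R I n) n = local_rank S J n"
proof -
  have zero_Q: "\<zero>\<^bsub>gr R I Quot K\<^esub> = K"
    by (simp add: FactRing_def)
  interpret h: ring_hom_ring "gr R I" "gr S J" gmap by (rule gr_map_ring_hom_ring)
  interpret G: cring "gr R I" by (rule source.cring_gr)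
  interpret K: ideal K "gr R I" by (rule h.kernel_is_ideal)
  let ?Q = "gr R I Quot K" and ?\<pi> = "\<lambda>f. K +>\<^bsub>gr R I\<^esub> f"
  let ?D = "\<lambda>n. ?\<pi> ` gr_part R I n"
  interpret Q: cring ?Q by (rule K.quotient_is_cring[OF source.cring_gr])
  interpret \<pi>: ring_hom_ring "gr R I" ?Q ?\<pi> by (rule K.rcos_ring_hom_ring)
  have D: "?D n \<subseteq> carrier ?Q" for n
    using source.gr_part_subset \<pi>.hom_closed by blast
  have "graded_rank ?Q ?D n = rel_rank ?Q (?D 0) (?D n) {\<zero>\<^bsub>?Q\<^esub>}"
    by (rule Q.graded_rank_eq_rel_rank) (rule D)
  also have "\<dots> = rel_rank R (carrier R) (ideal_pow R I n) {x. \<phi> x \<in> ideal_pow S J (Suc n)}"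
  proof (rule rel_rank_transfer[where f = "\<lambda>x. ?\<pi> (gr_hom R I n x)" and g = "\<lambda>x. ?\<pi> (gr_hom R I 0 x)", symmetric])
    let ?P = "ideal_pow R I n"
    show "?P \<subseteq> carrier R"
      using source.pow_carrier by blast
    have cy: "c \<otimes> y \<in> ?P" if "c \<in> carrier R" "y \<in> ?P" for c y
      using ideal.I_l_closed[OF source.pow_ideal] that by blast
    then show "x \<ominus> c \<otimes> y \<in> ?P" if "x \<in> ?P" "y \<in> ?P" "c \<in> carrier R" for x y c
      using that source.pow_minus by blast
    show "(\<lambda>x. ?\<pi> (gr_hom R I n x)) ` ?P = ?D n" "(\<lambda>x. ?\<pi> (gr_hom R I 0 x)) ` carrier R = ?D 0"
      by (simp_all add: source.gr_part_eq image_image)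
    show "?D n \<subseteq> carrier ?Q" by (rule D)
    show "?\<pi> (gr_hom R I n (x \<ominus> c \<otimes> y)) =
      ?\<pi> (gr_hom R I n x) \<ominus>\<^bsub>?Q\<^esub> ?\<pi> (gr_hom R I 0 c) \<otimes>\<^bsub>?Q\<^esub> ?\<pi> (gr_hom R I n y)"
      if "x \<in> ?P" "y \<in> ?P" "c \<in> carrier R" for x y c
    proof -
      have "gr_hom R I n (x \<ominus> c \<otimes> y) =
        gr_hom R I n x \<ominus>\<^bsub>gr R I\<^esub> gr_hom R I 0 c \<otimes>\<^bsub>gr R I\<^esub> gr_hom R I n y"
        using that cy source.hom_el_minus source.hom_el_mult by simp
      moreover have "gr_hom R I n x \<in> carrier (gr R I)" "gr_hom R I n y \<in> carrier (gr R I)"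
        "gr_hom R I 0 c \<in> carrier (gr R I)"
        using that source.hom_el_carrier by auto
      ultimately show ?thesis
        by (simp add: a_minus_def)
    qed
    show "?\<pi> (gr_hom R I n x) \<in> {\<zero>\<^bsub>?Q\<^esub>} \<longleftrightarrow> x \<in> {x. \<phi> x \<in> ideal_pow S J (Suc n)}" if "x \<in> ?P" for x
    proof -
      have c: "gr_hom R I n x \<in> carrier (gr R I)"
        using that source.hom_el_carrier by blast
      have "?\<pi> (gr_hom R I n x) = \<zero>\<^bsub>?Q\<^esub> \<longleftrightarrow> gr_hom R I n x \<in> K"
        unfolding zero_Q using K.rcos_const_imp_mem[OF c]
          ring.a_rcos_zero[OF cring.axioms(1)[OF source.cring_gr] h.kernel_is_ideal] by blast
      also have "\<dots> \<longleftrightarrow> \<phi> x \<in> ideal_pow S J (Suc n)"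
        by (rule hom_el_kernel_iff[OF that])
      finally show ?thesis by blast
    qed
  qed
  also have "\<dots> = rel_rank S (carrier S) (\<phi> ` ideal_pow R I n) (ideal_pow S J (Suc n))"
    by (rule rank_image[OF source.pow_ideal]) simp
  also have "\<dots> = local_rank S J n"
    by (simp add: target.local_rank_eq_rel_rank ideal_pow_image)
  finally show ?thesis .
qed

text \<open>The first isomorphism theorem for the surjection \<open>gmap\<close>. The induced map
  takes the coset of f to \<open>gmap f\<close>, from which compatibility with the grading
  follows.\<close>

lemma gr_quot_iso:
  "\<exists>h. h \<in> ring_iso (gr R I Quot K) (gr S J)
     \<and> (\<forall>f \<in> carrier (gr R I). h (K +>\<^bsub>gr R I\<^esub> f) = gmap f)
     \<and> (\<forall>n. h ` (\<lambda>f. K +>\<^bsub>gr R I\<^esub> f) ` gr_part R I n = gr_part S J n)"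
proof -
  interpret h: ring_hom_ring "gr R I" "gr S J" gmap by (rule gr_map_ring_hom_ring)
  let ?h = "\<lambda>X. the_elem (gmap ` X)"
  have h: "?h (K +>\<^bsub>gr R I\<^esub> f) = gmap f" if "f \<in> carrier (gr R I)" for f
    using h.the_elem_simp[OF that] .
  moreover have "?h ` (\<lambda>f. K +>\<^bsub>gr R I\<^esub> f) ` gr_part R I n = gr_part S J n" for n
    unfolding gr_map_part[of n, symmetric] image_image using source.gr_part_subset
    by (intro image_cong refl h) blast
  moreover have "?h \<in> ring_iso (gr R I Quot K) (gr S J)"
    by (rule h.FactRing_iso_set[OF gr_map_surj])
  ultimately show ?thesis by blast
qed

lemma local_rank_image:
  "local_rank S J n = rel_rank R (carrier R) (ideal_pow R I n) {x. \<phi> x \<in> ideal_pow S J (Suc n)}"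
  by (simp add: target.local_rank_eq_rel_rank ideal_pow_image[of n] rank_image[OF source.pow_ideal])

end

subsection \<open>Exact pairs of zero divisors\<close>

lemma (in cring) mult_image_ideal:
  assumes "ideal M R" "c \<in> carrier R"
  shows "ideal ((\<otimes>) c ` M) R"
proof -
  interpret M: ideal M R by (rule assms(1))
  show ?thesis
  proof (rule idealI)
    show "ring R" by (rule ring_axioms)
    show "subgroup ((\<otimes>) c ` M) (add_monoid R)"
    proof (rule add.subgroupI)
      show "(\<otimes>) c ` M \<subseteq> carrier R"
        using assms(2) by auto
      show "(\<otimes>) c ` M \<noteq> {}"
        using M.zero_closed by blast
      fix x y assume "x \<in> (\<otimes>) c ` M" "y \<in> (\<otimes>) c ` M"
      then obtain u v where uv: "u \<in> M" "x = c \<otimes> u" "v \<in> M" "y = c \<otimes> v" by blast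
      have "\<ominus> x = c \<otimes> (\<ominus> u)" "x \<oplus> y = c \<otimes> (u \<oplus> v)"
        using uv assms(2) by (simp_all add: r_minus r_distr)
      moreover have "\<ominus> u \<in> M" "u \<oplus> v \<in> M"
        using uv M.a_inv_closed additive_subgroup.a_closed[OF M.is_additive_subgroup] by auto
      ultimately show "\<ominus> x \<in> (\<otimes>) c ` M" "x \<oplus> y \<in> (\<otimes>) c ` M" by blast+
    qed
    fix x s assume "x \<in> (\<otimes>) c ` M" and s: "s \<in> carrier R"
    then obtain u where u: "u \<in> M" "x = c \<otimes> u" by blast
    have "s \<otimes> x = c \<otimes> (s \<otimes> u)" "x \<otimes> s = c \<otimes> (u \<otimes> s)"
      using u s assms(2) by (simp_all add: m_lcomm m_assoc)
    then show "s \<otimes> x \<in> (\<otimes>) c ` M" "x \<otimes> s \<in> (\<otimes>) c ` M"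
      using u s M.I_l_closed M.I_r_closed by blast+
  qed
qed

lemma (in cring) rank_mult_image:
  assumes M: "ideal M R" and c: "c \<in> carrier R" and N: "\<And>x. x \<in> M \<Longrightarrow> c \<otimes> x \<in> N' \<longleftrightarrow> x \<in> N"
  shows "rel_rank R (carrier R) M N = rel_rank R (carrier R) ((\<otimes>) c ` M) N'"
proof (rule rel_rank_transfer[where f = "(\<otimes>) c" and g = id])
  interpret M: ideal M R by (rule M)
  show "M \<subseteq> carrier R" by (rule M.a_subset)
  show "x \<ominus> s \<otimes> y \<in> M" if "x \<in> M" "y \<in> M" "s \<in> carrier R" for x y s
    using that M.minus_closed_I M.I_l_closed by blast
  show "c \<otimes> (x \<ominus> s \<otimes> y) = c \<otimes> x \<ominus> id s \<otimes> (c \<otimes> y)" if "x \<in> M" "y \<in> M" "s \<in> carrier R" for x y s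
  proof -
    have "x \<in> carrier R" "y \<in> carrier R" using that M.Icarr by blast+
    then have "c \<otimes> (x \<ominus> s \<otimes> y) = c \<otimes> x \<ominus> s \<otimes> (c \<otimes> y)"
      using that(3) c by algebra
    then show ?thesis by simp
  qed
  show "(\<otimes>) c ` M \<subseteq> carrier R"
    using c M.a_subset by auto
qed (use N in auto)

text \<open>The condition on the Hilbert series is left to the extension
  \<open>short_exact_pair\<close>, because it is first translated here into a relation between
  ranks.\<close>

locale short_pair = noetherian_maximal m R + comm_ideal m R for m and R (structure) +
  fixes a b
  assumes a: "a \<in> m" "a \<notin> ideal_pow R m 2" and b: "b \<in> m" "b \<notin> ideal_pow R m 2"
    and ann_a: "annihilator R a = PIdl b" and ann_b: "annihilator R b = PIdl a"
    and pow4: "ideal_pow R m 4 = {\<zero>}"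
begin

text \<open>The hypotheses are symmetric in a and b, so every fact proved for one element is
  available for the other.\<close>

lemma swap: "short_pair m R b a"
  by unfold_locales (rule a b ann_a ann_b pow4)+

lemma ab_carrier: "a \<in> carrier R" "b \<in> carrier R"
  using a b Icarr by blast+

lemma ann_a_iff: "x \<in> carrier R \<Longrightarrow> a \<otimes> x = \<zero> \<longleftrightarrow> (\<exists>r\<in>carrier R. x = b \<otimes> r)"
  using ann_a ab_carrier by (auto simp: annihilator_def cgenideal_def set_eq_iff m_comm[of b])

lemma ab_zero: "a \<otimes> b = \<zero>"
proof -
  have "\<exists>r\<in>carrier R. b = b \<otimes> r"
    using ab_carrier by (intro bexI[of _ \<one>]) auto
  then show ?thesis
    using ann_a_iff ab_carrier by blast
qed

text \<open>The difference x - y is killed by a, hence is a multiple of b.\<close>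

lemma mult_a_cancel:
  assumes "x \<in> carrier R" "y \<in> carrier R" "a \<otimes> x = a \<otimes> y"
  shows "\<exists>r\<in>carrier R. x \<ominus> b \<otimes> r = y"
proof -
  have "a \<otimes> (x \<ominus> y) = a \<otimes> x \<ominus> a \<otimes> y"
    using assms(1,2) ab_carrier by algebra
  then have "a \<otimes> (x \<ominus> y) = \<zero>"
    using assms ab_carrier by (simp add: a_minus_def r_neg)
  then obtain r where r: "r \<in> carrier R" "x \<ominus> y = b \<otimes> r"
    using ann_a_iff[of "x \<ominus> y"] assms by auto
  have "x \<ominus> (x \<ominus> y) = y" using assms(1,2) by algebra
  then show ?thesis
    using r by auto
qed

lemma pow_one': "ipow 1 = m"
  using pow_one by simp

lemma mult_m_pow: "\<lbrakk>t \<in> m; x \<in> ipow n\<rbrakk> \<Longrightarrow> t \<otimes> x \<in> ipow (Suc n)"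
  using pow_mult[of t 1 x n] pow_one' by simp

text \<open>An x outside m is invertible modulo m; since m a lies in m^2, a itself would then fall
  into m^2.\<close>

lemma mult_a_mem_pow2:
  assumes "x \<in> carrier R" "a \<otimes> x \<in> ipow 2"
  shows "x \<in> m"
proof (rule ccontr)
  assume "x \<notin> m"
  then obtain s where s: "s \<in> carrier R" "\<one> \<ominus> s \<otimes> x \<in> m"
    using inverse_mod_m assms(1) by blast
  have "(\<one> \<ominus> s \<otimes> x) \<otimes> a \<in> ipow 2"
    using mult_m_pow[OF s(2), of a 1] a pow_one' by (simp add: numeral_2_eq_2)
  moreover have "s \<otimes> (a \<otimes> x) \<in> ipow 2"
    using ideal.I_l_closed[OF pow_ideal assms(2) s(1)] .
  moreover have "a = (\<one> \<ominus> s \<otimes> x) \<otimes> a \<oplus> s \<otimes> (a \<otimes> x)"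
    using assms(1) s(1) ab_carrier by algebra
  ultimately show False
    using pow_add a(2) by metis
qed

lemma mult_a_pow: "x \<in> ipow n \<Longrightarrow> a \<otimes> x \<in> ipow (Suc n)"
  using mult_m_pow a by blast

lemma pow_ge_4: "n \<ge> 4 \<Longrightarrow> x \<in> ipow n \<Longrightarrow> x = \<zero>"
  using pow_antimono[of 4 n] pow4 by blast

text \<open>a m^3 lies in m^4 = 0, so m^3 is contained in the annihilator of a.\<close>

lemma pow3_subset_PIdl: "x \<in> ipow 3 \<Longrightarrow> \<exists>r\<in>carrier R. x = b \<otimes> r"
  using mult_a_pow[of x 3] pow4 ann_a_iff[OF pow_carrier, of x 3] by simp

text \<open>The swapped form of \<open>pow3_subset_PIdl\<close> puts m^3 into aR; the cofactor lies
  in m because the product lies in m^2.\<close>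

lemma ipow3_subset: "ipow 3 \<subseteq> (\<otimes>) a ` m"
proof
  fix x assume x: "x \<in> ipow 3"
  then obtain r where r: "r \<in> carrier R" "x = a \<otimes> r"
    using short_pair.pow3_subset_PIdl[OF swap] by blast
  moreover have "x \<in> ipow 2"
    using x pow_antimono[of 2 3] by auto
  ultimately show "x \<in> (\<otimes>) a ` m"
    using mult_a_mem_pow2 by blast
qed

lemma mult_a_pow2_subset: "(\<otimes>) a ` ipow 2 \<subseteq> ipow 3"
  using mult_a_pow[of _ 2] by auto

lemma mult_a_m_subset: "(\<otimes>) a ` m \<subseteq> ipow 2"
  using mult_a_pow[of _ 1] pow_one' by (auto simp: numeral_2_eq_2)

section \<open>Rank relations along the chain a m^2 \<subseteq> m^3 \<subseteq> a m \<subseteq>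
  m^2\<close>

lemmas ideals = pow_ideal mult_image_ideal[OF pow_ideal ab_carrier(1)]
  mult_image_ideal[OF is_ideal ab_carrier(1)] is_ideal

lemma rank_pow2: "rank (ipow 2) (ipow 3) = rank (ipow 2) ((\<otimes>) a ` m) + rank ((\<otimes>) a ` m) (ipow 3)"
  by (intro rank_add ideals ipow3_subset mult_a_m_subset)
    (use mult_m_pow[of _ _ 2] in simp)

lemma rank_mult_a_m:
  "rank ((\<otimes>) a ` m) ((\<otimes>) a ` ipow 2) = rank ((\<otimes>) a ` m) (ipow 3) + rank (ipow 3) ((\<otimes>) a ` ipow 2)"
proof (intro rank_add ideals ipow3_subset mult_a_pow2_subset)
  fix t x assume t: "t \<in> m" and "x \<in> (\<otimes>) a ` m"
  then obtain y where y: "y \<in> m" "x = a \<otimes> y" by blast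
  have "t \<otimes> y \<in> ipow 2"
    using mult_m_pow[of t y 1] t y pow_one' by (simp add: numeral_2_eq_2)
  moreover have "t \<otimes> x = a \<otimes> (t \<otimes> y)"
    using t y ab_carrier Icarr m_lcomm by metis
  ultimately show "t \<otimes> x \<in> (\<otimes>) a ` ipow 2" by blast
qed

lemma rank_pow3:
  "rank (ipow 3) {\<zero>} = rank (ipow 3) ((\<otimes>) a ` ipow 2) + rank ((\<otimes>) a ` ipow 2) {\<zero>}"
proof (intro rank_add ideals zeroideal mult_a_pow2_subset)
  show "{\<zero>} \<subseteq> (\<otimes>) a ` ipow 2"
    using ab_carrier r_null[of a] pow_zero[of 2] by (metis empty_subsetI imageI insert_subset)
  show "t \<otimes> x \<in> {\<zero>}" if "t \<in> m" "x \<in> ipow 3" for t x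
    using mult_m_pow[OF that] pow4 by simp
qed

text \<open>Multiplication by a on m^2 has kernel bR \<inter> m^2, which is b m because b r in m^2
  forces r into m.\<close>

lemma rank_mult_a_pow2: "rank (ipow 2) ((\<otimes>) b ` m) = rank ((\<otimes>) a ` ipow 2) {\<zero>}"
proof (rule rank_mult_image[OF pow_ideal ab_carrier(1)])
  fix x assume x: "x \<in> ipow 2"
  have "x = b \<otimes> r \<Longrightarrow> r \<in> carrier R \<Longrightarrow> r \<in> m" for r
    using short_pair.mult_a_mem_pow2[OF swap, of r] x by simp
  then show "a \<otimes> x \<in> {\<zero>} \<longleftrightarrow> x \<in> (\<otimes>) b ` m"
    using ann_a_iff[OF pow_carrier[OF x]] Icarr by blast
qed

text \<open>The ideal cR + m^2.\<close>

abbreviation pow2_plus where "pow2_plus c \<equiv> lspan R (carrier R) (ipow 2) [c]"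

text \<open>If a x = a y with y in m^2, then x - y is a multiple of b; so bR + m^2 is the kernel of
  the map from m onto a m / a m^2.\<close>

lemma rank_m_mult_a: "rank m (pow2_plus b) = rank ((\<otimes>) a ` m) ((\<otimes>) a ` ipow 2)"
proof (rule rank_mult_image[OF is_ideal ab_carrier(1)])
  fix x assume "x \<in> m"
  then have x: "x \<in> carrier R" by simp
  show "a \<otimes> x \<in> (\<otimes>) a ` ipow 2 \<longleftrightarrow> x \<in> pow2_plus b"
  proof
    assume "a \<otimes> x \<in> (\<otimes>) a ` ipow 2"
    then obtain y where y: "y \<in> ipow 2" "a \<otimes> x = a \<otimes> y" by blast
    have yc: "y \<in> carrier R" using y pow_carrier by blast
    then obtain r where r: "r \<in> carrier R" "x \<ominus> b \<otimes> r = y"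
      using mult_a_cancel[OF x yc y(2)] by blast
    then show "x \<in> pow2_plus b"
      using y x ab_carrier m_comm[of b r] by auto
  next
    assume "x \<in> pow2_plus b"
    then obtain r where r: "r \<in> carrier R" "x \<ominus> r \<otimes> b \<in> ipow 2" by auto
    have "a \<otimes> (x \<ominus> r \<otimes> b) = a \<otimes> x \<ominus> r \<otimes> (a \<otimes> b)"
      using r x ab_carrier by algebra
    then have "a \<otimes> x = a \<otimes> (x \<ominus> r \<otimes> b)"
      using ab_zero r x ab_carrier by (simp add: a_minus_def)
    then show "a \<otimes> x \<in> (\<otimes>) a ` ipow 2"
      using r by blast
  qed
qed

text \<open>(bR + m^2) / m^2 is spanned by b and is nonzero since b is not in m^2, so it accounts
  for exactly one dimension.\<close>

lemma rank_m: "rank m (ipow 2) = rank m (pow2_plus b) + 1"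
proof -
  have L: "ideal (pow2_plus b) R" "ipow 2 \<subseteq> pow2_plus b" "b \<in> pow2_plus b"
    using lspan_ideal[OF pow_ideal, of "[b]" 2] ab_carrier by auto
  have "pow2_plus b \<subseteq> m"
    using lspan_subset_ideal[OF is_ideal, of "ipow 2" "[b]"] pow_antimono[of 1 2] pow_one' b by auto
  then have "rank m (ipow 2) = rank m (pow2_plus b) + rank (pow2_plus b) (ipow 2)"
    using L mult_m_pow[of _ _ 1] pow_one' by (intro rank_add ideals) (auto simp: numeral_2_eq_2)
  moreover have "rank (pow2_plus b) (ipow 2) \<le> 1"
    using rank_le[of "[b]" "pow2_plus b" "ipow 2"] L by simp
  moreover have "rank (pow2_plus b) (ipow 2) \<noteq> 0"
    using rank_eq_0_iff[OF L(1) pow_ideal] L(3) b(2) by blast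
  ultimately show ?thesis by linarith
qed

lemma rank_carrier: "rank (carrier R) m = 1"
proof -
  have "\<one> \<notin> m"
    using I_notcarr one_imp_carrier by blast
  then have "rank (carrier R) m \<noteq> 0"
    using rank_eq_0_iff[OF oneideal is_ideal] by auto
  moreover have "rank (carrier R) m \<le> 1"
  proof -
    have "y \<ominus> y \<otimes> \<one> \<in> m" if "y \<in> carrier R" for y
      using that by (simp add: a_minus_def r_neg)
    then have "carrier R \<subseteq> lspan R (carrier R) m [\<one>]"
      by auto
    then show ?thesis
      using rank_le[of "[\<one>]" "carrier R" m] by simp
  qed
  ultimately show ?thesis by linarith
qed

lemma local_ranks: "local_rank R m 0 = 1" "local_rank R m 1 = rank m (ipow 2)"
  "local_rank R m 2 = rank (ipow 2) (ipow 3)" "local_rank R m 3 = rank (ipow 3) {\<zero>}"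
  "n \<ge> 4 \<Longrightarrow> local_rank R m n = 0"
proof -
  show "local_rank R m 0 = 1"
    using rank_carrier by (simp add: local_rank_eq_rel_rank pow_one)
  show "local_rank R m 1 = rank m (ipow 2)"
    unfolding local_rank_eq_rel_rank pow_one' by (simp add: numeral_2_eq_2)
  show "local_rank R m 2 = rank (ipow 2) (ipow 3)" "local_rank R m 3 = rank (ipow 3) {\<zero>}"
    unfolding local_rank_eq_rel_rank using pow4 by simp_all
  show "local_rank R m n = 0" if "n \<ge> 4"
  proof -
    have "ipow n \<subseteq> ipow (Suc n)"
      using pow_ge_4[OF that] by force
    then show ?thesis
      unfolding local_rank_eq_rel_rank using rank_eq_0_iff[OF pow_ideal pow_ideal] by blast
  qed
qed

text \<open>As m^4 = 0, the series is a polynomial of degree at most 3 with h_0 = 1, and its value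
  at -1 is h_0 - h_1 + h_2 - h_3. The relation avoids subtraction because ranks are natural
  numbers.\<close>

lemma euler_of_hilbert_series:
  assumes "fps_of_poly p = hilbert_series R m" "poly p (-1) = 0"
  shows "1 + local_rank R m 2 = local_rank R m 1 + local_rank R m 3"
proof -
  let ?h = "local_rank R m"
  have h: "Polynomial.coeff p n = of_nat (?h n)" for n
    using arg_cong[OF assms(1), of "\<lambda>f. fps_nth f n"] by (simp add: hilbert_series_def)
  have "p = [:of_nat (?h 0), of_nat (?h 1), of_nat (?h 2), of_nat (?h 3):]"
  proof (rule poly_eqI)
    fix n :: nat
    have "n = 0 \<or> n = 1 \<or> n = 2 \<or> n = 3 \<or> n \<ge> 4" by linarith
    then show "Polynomial.coeff p n =
        Polynomial.coeff [:of_nat (?h 0), of_nat (?h 1), of_nat (?h 2), of_nat (?h 3):] n"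
      unfolding h using local_ranks(5) by (auto simp: coeff_pCons eval_nat_numeral split: nat.split)
  qed
  then have "1 + rat_of_nat (?h 2) = of_nat (?h 1) + of_nat (?h 3)"
    using assms(2) local_ranks(1) by (simp add: algebra_simps)
  then show ?thesis
    by (metis of_nat_1 of_nat_add of_nat_eq_iff)
qed

end

section \<open>Annihilators of the initial forms\<close>

locale short_exact_pair = short_pair +
  assumes euler: "1 + local_rank R m 2 = local_rank R m 1 + local_rank R m 3"
begin

lemma swap': "short_exact_pair m R b a"
  using swap euler by (simp add: short_exact_pair_def short_exact_pair_axioms_def)

text \<open>With the Euler relation, h_2 = g_a + (h_1 - 1) - \<delta>_a becomes h_3 = g_a -
  \<delta>_a, while the swapped pair gives h_3 = g_a + \<delta>_b. Hence both defects vanish and g_a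
  = h_3.\<close>

lemma rank_defect:
  "rank (ipow 3) ((\<otimes>) a ` ipow 2) = 0" "rank (ipow 2) ((\<otimes>) a ` m) = rank (ipow 3) {\<zero>}"
proof -
  interpret sw: short_pair m R b a by (rule swap)
  note eqs = euler[unfolded local_ranks] rank_pow2 rank_mult_a_m rank_pow3 rank_mult_a_pow2
    rank_m_mult_a rank_m sw.rank_pow2 sw.rank_mult_a_m sw.rank_pow3 sw.rank_mult_a_pow2
    sw.rank_m_mult_a sw.rank_m
  show "rank (ipow 3) ((\<otimes>) a ` ipow 2) = 0" "rank (ipow 2) ((\<otimes>) a ` m) = rank (ipow 3) {\<zero>}"
    using eqs by linarith+
qed

lemma pow3_mult_a: "ipow 3 \<subseteq> (\<otimes>) a ` ipow 2"
  using rank_defect(1) rank_eq_0_iff[OF ideals(1) ideals(2)] by simp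

text \<open>The degree n + 1 part of the annihilator of the initial form of a, with one reason per
  degree: m^3 = a m^2 for n = 0, exactness of the pair for n = 1, m^3 = b m^2 for n = 2, and m^4 = 0
  beyond.\<close>

lemma ann_initial_degree:
  assumes x: "x \<in> ipow (Suc n)" and ax: "a \<otimes> x \<in> ipow (Suc (Suc (Suc n)))"
  shows "\<exists>y\<in>ipow n. x \<ominus> b \<otimes> y \<in> ipow (Suc (Suc n))"
proof -
  have xc: "x \<in> carrier R" using x pow_carrier by blast
  have exact: ?thesis if "r \<in> ipow n" "x = b \<otimes> r" for r
    using that xc by (intro bexI[of _ r]) (simp_all add: a_minus_def r_neg)
  consider "n = 0" | "n = 1" | "n = 2" | "n \<ge> 3" by linarith
  then show ?thesis
  proof cases
    case 1
    then have "a \<otimes> x \<in> ipow 3"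
      using ax by (simp add: numeral_3_eq_3)
    \<comment> \<open>Writing a x as a y with y in m^2 makes x - y a multiple of b, so y is the
      required error term.\<close>
    then have "a \<otimes> x \<in> (\<otimes>) a ` ipow 2"
      using pow3_mult_a by blast
    then obtain y where y: "y \<in> ipow 2" "a \<otimes> x = a \<otimes> y" by blast
    have yc: "y \<in> carrier R" using y pow_carrier by blast
    then obtain r where "r \<in> carrier R" "x \<ominus> b \<otimes> r = y"
      using mult_a_cancel[OF xc yc y(2)] by blast
    then show ?thesis
      using 1 y by (auto simp: numeral_2_eq_2)
  next
    case 2
    then have "a \<otimes> x = \<zero>"
      using pow_ge_4[of 4 "a \<otimes> x"] ax by (simp add: eval_nat_numeral)
    then obtain r where r: "r \<in> carrier R" "x = b \<otimes> r"
      using ann_a_iff xc by blast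
    moreover have "x \<in> ipow 2"
      using x 2 by (simp add: numeral_2_eq_2)
    ultimately have "r \<in> m"
      using short_pair.mult_a_mem_pow2[OF swap] by blast
    then show ?thesis
      using exact r 2 pow_one' by blast
  next
    case 3
    then have "x \<in> ipow 3"
      using x by simp
    then show ?thesis
      using short_exact_pair.pow3_mult_a[OF swap'] exact 3 by blast
  next
    case 4
    then have "x = \<zero>"
      using pow_ge_4[of "Suc n" x] x by simp
    then show ?thesis
      using exact[of \<zero>] ab_carrier by simp
  qed
qed

lemma initial_forms: "initial_form R m a = hom_el 1 a" "initial_form R m b = hom_el 1 b"
  using initial_form_eq[of a 1] initial_form_eq[of b 1] a b pow_one' by (auto simp: numeral_2_eq_2)

lemma initial_forms_props:
  "hom_el 1 a \<in> carrier G" "hom_el 1 a \<noteq> \<zero>\<^bsub>G\<^esub>" "hom_el 1 a \<otimes>\<^bsub>G\<^esub> hom_el 1 b = \<zero>\<^bsub>G\<^esub>"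
proof -
  show "hom_el 1 a \<in> carrier G"
    using hom_el_carrier a pow_one' by blast
  show "hom_el 1 a \<noteq> \<zero>\<^bsub>G\<^esub>"
    using hom_el_eq_zero_iff[OF ab_carrier(1), of 1] a(2) by (simp add: numeral_2_eq_2)
  have "hom_el 1 a \<otimes>\<^bsub>G\<^esub> hom_el 1 b = cls (\<lambda>n. if n < 1 then \<zero> else a \<otimes> (if n - 1 = 1 then b else \<zero>))"
    unfolding gr_hom_def[of R m 1 b] using a b pow_one'
    by (intro hom_el_mult_cls hom_seq_pow) auto
  also have "(\<lambda>n. if n < 1 then \<zero> else a \<otimes> (if n - 1 = 1 then b else \<zero>)) = (\<lambda>n::nat. \<zero>)"
    using ab_zero ab_carrier by auto
  finally show "hom_el 1 a \<otimes>\<^bsub>G\<^esub> hom_el 1 b = \<zero>\<^bsub>G\<^esub>"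
    using gr_zero by simp
qed

text \<open>One inclusion is assembled degree by degree from \<open>ann_initial_degree\<close>; the
  other holds because the two initial forms multiply to zero.\<close>

lemma annihilator_initial_form: "annihilator G (hom_el 1 a) = PIdl\<^bsub>G\<^esub> (hom_el 1 b)"
proof (intro equalityI subsetI)
  interpret G: cring G by (rule cring_gr)
  fix f assume "f \<in> annihilator G (hom_el 1 a)"
  then obtain x where x: "x \<in> rees R m" "f = cls x" "hom_el 1 a \<otimes>\<^bsub>G\<^esub> cls x = \<zero>\<^bsub>G\<^esub>"
    using carrier_gr by (auto simp: annihilator_def)
  have "cls (\<lambda>n. if n < 1 then \<zero> else a \<otimes> x (n - 1)) = \<zero>\<^bsub>G\<^esub>"
    using hom_el_mult_cls[of a 1 x] reesD(1)[OF x(1)] a pow_one' x(3) by simp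
  then have "\<forall>n. (if n < 1 then \<zero> else a \<otimes> x (n - 1)) \<in> ipow (Suc n)"
    using reesD(2)[OF x(1)] ab_carrier by (subst (asm) cls_eq_zero_iff) auto
  \<comment> \<open>Component n + 1 of the product is a x_n, and a zero component in that degree
    means membership in m^(n+2).\<close>
  then have ax: "a \<otimes> x n \<in> ipow (Suc (Suc n))" for n
    by (metis diff_Suc_1 less_one nat.distinct(1))
  have "x 0 \<in> m"
    using mult_a_mem_pow2[OF reesD(2)[OF x(1)]] ax[of 0] by (simp add: numeral_2_eq_2)
  then show "f \<in> PIdl\<^bsub>G\<^esub> (hom_el 1 b)"
    unfolding x(2) using b x(1) ann_initial_degree[OF reesD(1)[OF x(1)] ax]
    by (intro cls_in_PIdl) auto
next
  interpret G: cring G by (rule cring_gr)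
  interpret sw: short_exact_pair m R b a by (rule swap')
  fix f assume "f \<in> PIdl\<^bsub>G\<^esub> (hom_el 1 b)"
  then obtain g where g: "g \<in> carrier G" "f = g \<otimes>\<^bsub>G\<^esub> hom_el 1 b"
    by (auto simp: cgenideal_def)
  then have "hom_el 1 a \<otimes>\<^bsub>G\<^esub> f = g \<otimes>\<^bsub>G\<^esub> (hom_el 1 a \<otimes>\<^bsub>G\<^esub> hom_el 1 b)"
    using initial_forms_props(1) sw.initial_forms_props(1) by (simp add: G.m_lcomm)
  then show "f \<in> annihilator G (hom_el 1 a)"
    using g initial_forms_props sw.initial_forms_props(1) by (simp add: annihilator_def)
qed

text \<open>An inverse would cancel from the zero product of the two initial forms and make the
  nonzero initial form of b vanish.\<close>

lemma initial_form_not_unit: "hom_el 1 a \<notin> Units G"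
proof
  interpret G: cring G by (rule cring_gr)
  interpret sw: short_exact_pair m R b a by (rule swap')
  assume "hom_el 1 a \<in> Units G"
  then obtain u where u: "u \<in> carrier G" "u \<otimes>\<^bsub>G\<^esub> hom_el 1 a = \<one>\<^bsub>G\<^esub>"
    by (auto simp: Units_def)
  have "hom_el 1 b = (u \<otimes>\<^bsub>G\<^esub> hom_el 1 a) \<otimes>\<^bsub>G\<^esub> hom_el 1 b"
    using u sw.initial_forms_props(1) by simp
  also have "\<dots> = \<zero>\<^bsub>G\<^esub>"
    using u(1) initial_forms_props sw.initial_forms_props(1) by (simp add: G.m_assoc del: u(2))
  finally show False
    using sw.initial_forms_props(2) by simp
qed

lemma exact_zd_pair_gr: "exact_zd_pair G (initial_form R m a) (initial_form R m b)"
proof -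
  interpret sw: short_exact_pair m R b a by (rule swap')
  show ?thesis
    unfolding exact_zd_pair_def initial_forms
    using initial_forms_props sw.initial_forms_props annihilator_initial_form
      sw.annihilator_initial_form initial_form_not_unit sw.initial_form_not_unit by simp
qed

section \<open>The quotient by a: kernel of the graded map and Hilbert series\<close>

abbreviation Ra where "Ra \<equiv> R Quot (PIdl a)"
abbreviation quot_map where "quot_map \<equiv> \<lambda>x. PIdl a +> x"
abbreviation ma where "ma \<equiv> quot_map ` m"

lemma surj_gr_quot: "surj_gr m R ma Ra quot_map"
proof -
  interpret A: ideal "PIdl a" R by (rule cgenideal_ideal[OF ab_carrier(1)])
  have "cring Ra" by (rule A.quotient_is_cring[OF is_cring])
  moreover have "ideal ma Ra"
    by (rule ring_ideal_imp_quot_ideal[OF A.is_ideal is_ideal])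
  moreover have "ring_hom_cring R Ra quot_map"
    by (rule A.rcos_ring_hom_cring[OF is_cring])
  moreover have "quot_map ` carrier R = carrier Ra"
    by (auto simp: FactRing_simps)
  ultimately show ?thesis
    using comm_ideal_axioms
    by (simp add: surj_gr_def surj_gr_axioms_def comm_ideal_def)
qed

sublocale quot: surj_gr m R ma Ra quot_map
  by (rule surj_gr_quot)

lemma quot_map_eq_iff:
  assumes "x \<in> carrier R" "y \<in> carrier R"
  shows "quot_map x = quot_map y \<longleftrightarrow> (\<exists>r\<in>carrier R. x \<ominus> y = r \<otimes> a)"
  using quotient_eq_iff_same_a_r_cos[OF cgenideal_ideal[OF ab_carrier(1)] assms]
  by (auto simp: cgenideal_def)

text \<open>Powers of m/aR are images of powers of m, so their preimages are aR + m^k; this moves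
  the remaining computations back into R.\<close>

lemma quot_mem_pow_iff:
  assumes x: "x \<in> carrier R"
  shows "quot_map x \<in> ideal_pow Ra ma k \<longleftrightarrow> (\<exists>r\<in>carrier R. x \<ominus> a \<otimes> r \<in> ipow k)"
proof
  assume "quot_map x \<in> ideal_pow Ra ma k"
  then obtain z where z: "z \<in> ipow k" "quot_map x = quot_map z"
    unfolding quot.ideal_pow_image by blast
  then obtain r where r: "r \<in> carrier R" "x \<ominus> z = r \<otimes> a"
    using quot_map_eq_iff[OF x] pow_carrier by blast
  have "x \<ominus> (x \<ominus> z) = z"
    using x pow_carrier[OF z(1)] by algebra
  then show "\<exists>r\<in>carrier R. x \<ominus> a \<otimes> r \<in> ipow k"
    using r z(1) ab_carrier m_comm by metis
next
  assume "\<exists>r\<in>carrier R. x \<ominus> a \<otimes> r \<in> ipow k"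
  then obtain r where r: "r \<in> carrier R" "x \<ominus> a \<otimes> r \<in> ipow k" by blast
  have "x \<ominus> (x \<ominus> a \<otimes> r) = r \<otimes> a"
    using x r(1) ab_carrier by algebra
  then have "quot_map x = quot_map (x \<ominus> a \<otimes> r)"
    using quot_map_eq_iff[OF x, of "x \<ominus> a \<otimes> r"] x r ab_carrier by auto
  then show "quot_map x \<in> ideal_pow Ra ma k"
    unfolding quot.ideal_pow_image using r(2) by blast
qed

text \<open>Improves an arbitrary cofactor r to one of the expected order n. For n = 1, a r in m^2
  forces r into m; for n = 2, m^3 = a m^2; for larger n, x is zero.\<close>

lemma quot_initial_degree:
  assumes x: "x \<in> ipow (Suc n)" and r: "r \<in> carrier R" "x \<ominus> a \<otimes> r \<in> ipow (Suc (Suc n))"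
  shows "\<exists>y\<in>ipow n. x \<ominus> a \<otimes> y \<in> ipow (Suc (Suc n))"
proof -
  have xc: "x \<in> carrier R" using x pow_carrier by blast
  have exact: ?thesis if "y \<in> ipow n" "x = a \<otimes> y" for y
    using that xc by (intro bexI[of _ y]) (simp_all add: a_minus_def r_neg)
  consider "n = 0" | "n = 1" | "n = 2" | "n \<ge> 3" by linarith
  then show ?thesis
  proof cases
    case 1
    then show ?thesis using r by auto
  next
    case 2
    have "x \<in> ipow 2" "x \<ominus> a \<otimes> r \<in> ipow 2"
      using x r(2) 2 pow_antimono[of 2 3] by (auto simp: eval_nat_numeral)
    moreover have "a \<otimes> r = x \<ominus> (x \<ominus> a \<otimes> r)"
      using xc r(1) ab_carrier by algebra
    ultimately have "a \<otimes> r \<in> ipow 2"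
      using pow_minus by metis
    then have "r \<in> ipow n"
      using mult_a_mem_pow2[OF r(1)] pow_one' 2 by simp
    then show ?thesis using r(2) by blast
  next
    case 3
    then have "x \<in> ipow 3"
      using x by simp
    then show ?thesis
      using pow3_mult_a exact 3 by blast
  next
    case 4
    then have "x = \<zero>"
      using pow_ge_4[of "Suc n" x] x by simp
    then show ?thesis
      using exact[of \<zero>] ab_carrier by simp
  qed
qed

text \<open>The initial form of a dies because a maps to zero. Conversely, each component of a
  kernel element lies in aR modulo the next power, and \<open>quot_initial_degree\<close> supplies
  the cofactors that \<open>cls_in_PIdl\<close> requires.\<close>

lemma kernel_gr_quot: "quot.K = PIdl\<^bsub>G\<^esub> (hom_el 1 a)"
proof
  have "a \<ominus> a \<otimes> \<one> = \<zero>"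
    using ab_carrier by (simp add: a_minus_def r_neg)
  then have "quot_map a \<in> ideal_pow Ra ma (Suc 1)"
    using quot_mem_pow_iff[OF ab_carrier(1), of "Suc 1"] one_closed pow_zero by metis
  then have "hom_el 1 a \<in> quot.K"
    using quot.hom_el_kernel_iff[of a 1] a pow_one' by blast
  then show "PIdl\<^bsub>G\<^esub> (hom_el 1 a) \<subseteq> quot.K"
    using ring.cgenideal_minimal[OF cring.axioms(1)[OF cring_gr]
        ring_hom_ring.kernel_is_ideal[OF quot.gr_map_ring_hom_ring]] by blast
  show "quot.K \<subseteq> PIdl\<^bsub>G\<^esub> (hom_el 1 a)"
  proof
    fix f assume "f \<in> quot.K"
    then obtain x where x: "x \<in> rees R m" "f = cls x" "quot.gmap (cls x) = \<zero>\<^bsub>gr Ra ma\<^esub>"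
      using carrier_gr quot.kernel_gr_map_iff by auto
    have qc: "quot_map (x n) \<in> carrier Ra" for n
      using reesD(2)[OF x(1)] quot.phi.hom_closed by blast
    have "gr_class Ra ma (\<lambda>n. quot_map (x n)) = \<zero>\<^bsub>gr Ra ma\<^esub>"
      using x(3) quot.gr_map_cls[OF reesD(2)[OF x(1)]] by simp
    then have "\<forall>n. quot_map (x n) \<in> ideal_pow Ra ma (Suc n)"
      using quot.target.cls_eq_zero_iff[of "\<lambda>n. quot_map (x n)", OF qc] by blast
    then have r: "\<exists>r\<in>carrier R. x n \<ominus> a \<otimes> r \<in> ipow (Suc n)" for n
      using quot_mem_pow_iff[OF reesD(2)[OF x(1)]] by blast
    obtain r where r0: "r \<in> carrier R" "x 0 \<ominus> a \<otimes> r \<in> m"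
      using r[of 0] pow_one by auto
    have "x 0 \<in> m"
      using minus_mem_cancel[OF reesD(2)[OF x(1)] _ r0(2)] I_r_closed a(1) r0(1) by blast
    moreover have "\<exists>y\<in>ipow n. x (Suc n) \<ominus> a \<otimes> y \<in> ipow (Suc (Suc n))" for n
      using r[of "Suc n"] quot_initial_degree[OF reesD(1)[OF x(1)]] by blast
    ultimately show "f \<in> PIdl\<^bsub>G\<^esub> (hom_el 1 a)"
      unfolding x(2) using cls_in_PIdl[OF a(1) x(1)] by blast
  qed
qed

section \<open>Ranks and Hilbert series of R/aR\<close>

lemma rank_cong: "(\<And>x. x \<in> M \<Longrightarrow> x \<in> N \<longleftrightarrow> x \<in> N') \<Longrightarrow> ideal M R \<Longrightarrow> rank M N = rank M N'"
  using rel_rank_transfer[of M R "carrier R" id M R id "carrier R" N' N]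
    ideal.minus_closed_I[of M R] ideal.I_l_closed[of M R] additive_subgroup.a_subset[of M R]
  by (simp add: ideal.axioms(1))

text \<open>The rank of R/aR in degree n is that of m^n modulo m^n \<inter> (aR + m^(n+1)). This
  submodule is m for n = 0, aR + m^2 for n = 1, a m for n = 2, and all of m^n from n = 3 on; the
  rank g_a found in degree 2 equals h_3 by \<open>rank_defect\<close>.\<close>

lemma local_rank_quot:
  "local_rank Ra ma 0 = 1" "local_rank R m 1 = local_rank Ra ma 1 + 1"
  "local_rank Ra ma 2 = local_rank R m 3" "n \<ge> 3 \<Longrightarrow> local_rank Ra ma n = 0"
proof -
  have rk: "local_rank Ra ma n = rank (ipow n) {x \<in> ipow n. \<exists>r\<in>carrier R. x \<ominus> a \<otimes> r \<in> ipow (Suc n)}" for n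
    unfolding quot.local_rank_image using quot_mem_pow_iff pow_carrier
    by (intro rank_cong pow_ideal) blast
  have "\<exists>r\<in>carrier R. x \<ominus> a \<otimes> r \<in> m" if "x \<in> m" for x
    using that ab_carrier Icarr by (intro bexI[of _ \<zero>]) (simp_all add: a_minus_def)
  moreover have "x \<in> m" if "x \<in> carrier R" "\<exists>r\<in>carrier R. x \<ominus> a \<otimes> r \<in> m" for x
    using that minus_mem_cancel I_r_closed a(1) by blast
  ultimately have "{x \<in> ipow 0. \<exists>r\<in>carrier R. x \<ominus> a \<otimes> r \<in> ipow (Suc 0)} = m"
    unfolding pow_one ideal_pow.simps(1) using Icarr by blast
  then show "local_rank Ra ma 0 = 1"
    unfolding rk using rank_carrier by simp
  interpret sw: short_pair m R b a by (rule swap)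
  \<comment> \<open>The swapped pair is used because \<open>rank_m\<close> for (a, b) concerns bR +
    m^2, whereas aR + m^2 is needed.\<close>
  have "rank m {x \<in> ipow 1. \<exists>r\<in>carrier R. x \<ominus> a \<otimes> r \<in> ipow (Suc 1)} = rank m (pow2_plus a)"
    using pow_one' Icarr ab_carrier m_comm[of a]
    by (intro rank_cong is_ideal) (auto simp: numeral_2_eq_2)
  then show "local_rank R m 1 = local_rank Ra ma 1 + 1"
    unfolding rk local_ranks(2) sw.rank_m by (simp add: pow_one)
  \<comment> \<open>Since m^3 lies in a m, adding m^3 to aR contributes nothing new; a multiple of a
    that lies in m^2 has its cofactor in m.\<close>
  have "rank (ipow 2) {x \<in> ipow 2. \<exists>r\<in>carrier R. x \<ominus> a \<otimes> r \<in> ipow (Suc 2)} = rank (ipow 2) ((\<otimes>) a ` m)"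
  proof (rule rank_cong[OF _ pow_ideal])
    fix x assume x: "x \<in> ipow 2"
    have xc: "x \<in> carrier R" using x pow_carrier by blast
    show "x \<in> {x \<in> ipow 2. \<exists>r\<in>carrier R. x \<ominus> a \<otimes> r \<in> ipow (Suc 2)} \<longleftrightarrow> x \<in> (\<otimes>) a ` m"
    proof
      assume "x \<in> {x \<in> ipow 2. \<exists>r\<in>carrier R. x \<ominus> a \<otimes> r \<in> ipow (Suc 2)}"
      then obtain r where r: "r \<in> carrier R" "x \<ominus> a \<otimes> r \<in> ipow 3" by auto
      then obtain s where s: "s \<in> m" "x \<ominus> a \<otimes> r = a \<otimes> s"
        using ipow3_subset by blast
      have "x = (x \<ominus> a \<otimes> r) \<oplus> a \<otimes> r"
        using xc r(1) ab_carrier by algebra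
      also have "\<dots> = a \<otimes> (s \<oplus> r)"
        unfolding s(2) using s(1) r(1) ab_carrier Icarr r_distr by simp
      finally have "x = a \<otimes> (s \<oplus> r)" .
      moreover have "s \<oplus> r \<in> m"
        using mult_a_mem_pow2[of "s \<oplus> r"] calculation x s(1) r(1) Icarr by simp
      ultimately show "x \<in> (\<otimes>) a ` m" by blast
    next
      assume "x \<in> (\<otimes>) a ` m"
      then obtain r where "r \<in> m" "x = a \<otimes> r" by blast
      then show "x \<in> {x \<in> ipow 2. \<exists>r\<in>carrier R. x \<ominus> a \<otimes> r \<in> ipow (Suc 2)}"
        using x xc Icarr by (auto simp: a_minus_def r_neg intro!: bexI[of _ r])
    qed
  qed
  then show "local_rank Ra ma 2 = local_rank R m 3"
    unfolding rk local_ranks(4) using rank_defect(2) by simp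
  show "local_rank Ra ma n = 0" if "n \<ge> 3"
  proof -
    have "ipow n \<subseteq> {x \<in> ipow n. \<exists>r\<in>carrier R. x \<ominus> a \<otimes> r \<in> ipow (Suc n)}"
    proof
      fix x assume x: "x \<in> ipow n"
      then have "x \<in> ipow 3"
        using pow_antimono[OF that] by blast
      then obtain r where r: "r \<in> m" "x = a \<otimes> r"
        using ipow3_subset by blast
      then have "x \<ominus> a \<otimes> r = \<zero>"
        using ab_carrier Icarr by (simp add: a_minus_def r_neg)
      then show "x \<in> {x \<in> ipow n. \<exists>r\<in>carrier R. x \<ominus> a \<otimes> r \<in> ipow (Suc n)}"
        using x r(1) Icarr pow_zero by (metis (mono_tags, lifting) mem_Collect_eq)
    qed
    then show ?thesis
      unfolding rk using rank_le[of "[]"] by simp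
  qed
qed

text \<open>Compares coefficients in H_R = H_{R/aR} (1 + t). In degree 2 the identity is h_2 = h_3 +
  (h_1 - 1), the Euler relation itself; the other degrees follow directly from the ranks of
  R/aR.\<close>

lemma hilbert_series_quot: "hilbert_series Ra ma = hilbert_series R m * inverse (1 + fps_X)"
proof -
  have "local_rank R m (Suc n) = local_rank Ra ma (Suc n) + local_rank Ra ma n" for n
  proof -
    consider "n = 0" | "n = 1" | "n = 2" | "n \<ge> 3" by linarith
    then show ?thesis
    proof cases
      case 1
      then show ?thesis using local_rank_quot(1,2) by simp
    next
      case 2
      then show ?thesis using local_rank_quot(2,3) euler by (simp add: numeral_2_eq_2)
    next
      case 3
      then show ?thesis using local_rank_quot(3,4) by simp
    next
      case 4
      then show ?thesis using local_rank_quot(4) local_ranks(5) by simp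
    qed
  qed
  then have "hilbert_series R m = hilbert_series Ra ma * (1 + fps_X)"
    using local_rank_quot(1) local_ranks(1)
    by (intro fps_ext) (auto simp: hilbert_series_def distrib_left gr0_conv_Suc)
  then have "hilbert_series R m * inverse (1 + fps_X) =
    hilbert_series Ra ma * ((1 + fps_X) * inverse (1 + fps_X))"
    by (simp add: mult.assoc)
  also have "(1 + fps_X) * inverse (1 + fps_X :: rat fps) = 1"
    by (rule inverse_mult_eq_1') simp
  finally show ?thesis by simp
qed

lemma graded_hilbert_series_quot:
  "graded_hilbert_series (G Quot PIdl\<^bsub>G\<^esub> (hom_el 1 a))
     (\<lambda>n. (\<lambda>f. PIdl\<^bsub>G\<^esub> (hom_el 1 a) +>\<^bsub>G\<^esub> f) ` gr_part R m n) = hilbert_series Ra ma"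
  using quot.graded_rank_quot unfolding kernel_gr_quot
  by (simp add: graded_hilbert_series_def hilbert_series_def)

end

theorem theorem2p5:
  fixes R :: "('a, 'b) ring_scheme" and m :: "'a set" and a b :: 'a
  assumes loc: "local_noetherian R m"
    and m4: "ideal_pow R m 4 = {\<zero>\<^bsub>R\<^esub>}"
    and H: "\<exists>p. fps_of_poly p = hilbert_series R m \<and> poly p (-1) = 0"
    and a: "a \<in> m - ideal_pow R m 2" and b: "b \<in> m - ideal_pow R m 2"
    and ab: "exact_zd_pair R a b"
  shows "exact_zd_pair (gr R m) (initial_form R m a) (initial_form R m b)
    \<and> (let Ra = R Quot (PIdl\<^bsub>R\<^esub> a); ma = (\<lambda>x. PIdl\<^bsub>R\<^esub> a +>\<^bsub>R\<^esub> x) ` m;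
           G = gr R m; A = PIdl\<^bsub>G\<^esub> (initial_form R m a); Q = G Quot A;
           DQ = (\<lambda>n. (\<lambda>f. A +>\<^bsub>G\<^esub> f) ` gr_part R m n) in
        (\<exists>h. h \<in> ring_iso Q (gr Ra ma)
             \<and> (\<forall>f \<in> carrier G. h (A +>\<^bsub>G\<^esub> f) = gr_map R m Ra ma (\<lambda>x. PIdl\<^bsub>R\<^esub> a +>\<^bsub>R\<^esub> x) f)
             \<and> (\<forall>n. h ` DQ n = gr_part Ra ma n))
        \<and> graded_hilbert_series Q DQ = hilbert_series Ra ma
        \<and> hilbert_series Ra ma = hilbert_series R m * inverse (1 + fps_X))"
proof -
  interpret cring R using loc by (simp add: local_noetherian_def)
  interpret noetherian_ring R using loc by (simp add: local_noetherian_def)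
  interpret maximalideal m R using loc by (simp add: local_noetherian_def)
  interpret short_pair m R a b
    using a b ab m4 by unfold_locales (auto simp: exact_zd_pair_def)
  interpret short_exact_pair m R a b
    using H euler_of_hilbert_series by unfold_locales blast
  show ?thesis
    unfolding Let_def
    \<comment> \<open>Rewriting the kernel as the principal ideal of the initial form of a turns the
      first isomorphism theorem into the claimed natural isomorphism.\<close>
    using exact_zd_pair_gr quot.gr_quot_iso graded_hilbert_series_quot hilbert_series_quot
    unfolding kernel_gr_quot initial_forms by blast
qed

end
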